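(* Let $\varepsilon=2$ and let $f_\varepsilon:\mathbb{T}^2\to\mathbb{T}^2$, $\mathbb{T}^2=\mathbb{R}^2/\mathbb{Z}^2$, be the standard map $$f_\varepsilon(x,y)=\left(x+y+\frac{\varepsilon}{2\pi}\sin(2\pi x)\ \mathrm{mod}\ 1,\ \ y+\frac{\varepsilon}{2\pi}\sin(2\pi x)\ \mathrm{mod}\ 1\right).$$ Then its topological entropy satisfies $h(f_\varepsilon)\ge 0.54518888942276$.
   Context: Topological entropy: for a continuous map $f:X\to X$ of a compact metric space, a set $W\subset X$ is $(n,\delta)$-separated if for any two distinct $x,y\in W$ the distance between $f^k(x)$ and $f^k(y)$ exceeds $\delta$ for some $0\le k<n$; with $s(n,\delta)$ the maximal cardinality of an $(n,\delta)$-separated set, $h(f)=\sup_{\delta>0}\limsup_{n\to\infty}\frac{\log s(n,\delta)}{n}$ (natural logarithm). *)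

theory Defs
  imports "HOL-Analysis.Analysis"
begin

section \<open>Topological entropy\<close>

definition separated_set :: "('a::metric_space \<Rightarrow> 'a) \<Rightarrow> nat \<Rightarrow> real \<Rightarrow> 'a set \<Rightarrow> bool" where
  "separated_set f n \<delta> W \<longleftrightarrow>
     (\<forall>x\<in>W. \<forall>y\<in>W. x \<noteq> y \<longrightarrow> (\<exists>k<n. dist ((f ^^ k) x) ((f ^^ k) y) > \<delta>))"

text \<open>The maximum below exists when \<open>X\<close> is compact and \<open>f\<close> is a continuous self-map of \<open>X\<close>;
  see \<open>max_separated\<close>.\<close>

definition max_separated :: "'a::metric_space set \<Rightarrow> ('a \<Rightarrow> 'a) \<Rightarrow> nat \<Rightarrow> real \<Rightarrow> nat" where
  "max_separated X f n \<delta> =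
     (GREATEST s. \<exists>W\<subseteq>X. finite W \<and> separated_set f n \<delta> W \<and> card W = s)"

definition topological_entropy :: "'a::metric_space set \<Rightarrow> ('a \<Rightarrow> 'a) \<Rightarrow> ereal" where
  "topological_entropy X f =
     (SUP \<delta>\<in>{0<..}. limsup (\<lambda>n. ereal (ln (real (max_separated X f n \<delta>)) / real n)))"

lemma funpow_image_subset:
  assumes "f ` X \<subseteq> X" shows "(f ^^ k) ` X \<subseteq> X"
proof (induction k)
  case (Suc k)
  have "(f ^^ Suc k) ` X = f ` (f ^^ k) ` X" by (simp add: image_comp)
  also have "\<dots> \<subseteq> f ` X" using Suc by (rule image_mono)
  finally show ?case using assms by simp
qed simp

lemma continuous_on_funpow:
  fixes f :: "'a::topological_space \<Rightarrow> 'a"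
  assumes "continuous_on X f" "f ` X \<subseteq> X"
  shows "continuous_on X (f ^^ k)"
proof (induction k)
  case (Suc k)
  have "continuous_on ((f ^^ k) ` X) f"
    by (rule continuous_on_subset[OF assms(1) funpow_image_subset[OF assms(2)]])
  then show ?case using continuous_on_compose[OF Suc] by simp
qed (simp add: id_def)

lemma separated_set_bounded:
  fixes f :: "'a::metric_space \<Rightarrow> 'a"
  assumes X: "compact X" and f: "continuous_on X f" "f ` X \<subseteq> X" and \<delta>: "\<delta> > 0"
  obtains N where "\<And>W. W \<subseteq> X \<Longrightarrow> separated_set f n \<delta> W \<Longrightarrow> finite W \<and> card W \<le> N"
proof -
  have "\<exists>d>0. \<forall>x\<in>X. \<forall>y\<in>X. dist x y < d \<longrightarrow> dist ((f ^^ k) x) ((f ^^ k) y) < \<delta>" for k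
  proof -
    have "uniformly_continuous_on X (f ^^ k)"
      using X compact_uniformly_continuous continuous_on_funpow[OF f] by blast
    then show ?thesis using \<delta> unfolding uniformly_continuous_on_def by (metis dist_commute)
  qed
  then obtain d where d0: "\<And>k. d k > 0"
    and d: "\<And>k x y. x \<in> X \<Longrightarrow> y \<in> X \<Longrightarrow> dist x y < d k \<Longrightarrow> dist ((f ^^ k) x) ((f ^^ k) y) < \<delta>"
    by metis
  define e where "e = Min (insert 1 (d ` {..<n}))"
  have e0: "e > 0" using d0 by (auto simp: e_def)
  have e: "e \<le> d k" if "k < n" for k using that by (auto simp: e_def)
  obtain C where C: "finite C" "C \<subseteq> X" "X \<subseteq> (\<Union>x\<in>C. ball x (e/2))"
    using compactE_image[OF X, of X "\<lambda>x. ball x (e/2)"] e0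
    by (metis UN_I centre_in_ball half_gt_zero open_ball subsetI)
  show ?thesis
  proof (rule that[of "card C"])
    fix W assume W: "W \<subseteq> X" "separated_set f n \<delta> W"
    have "\<exists>c. c \<in> C \<and> dist c x < e/2" if "x \<in> W" for x
      using C(3) W(1) that by fastforce
    then obtain g where g: "\<And>x. x \<in> W \<Longrightarrow> g x \<in> C \<and> dist (g x) x < e/2" by metis
    have "inj_on g W"
    proof (rule inj_onI, rule ccontr)
      fix x y assume xy: "x \<in> W" "y \<in> W" "g x = g y" "x \<noteq> y"
      have "dist x y < e" using g[OF xy(1)] g[OF xy(2)] xy(3)
        by (metis dist_commute dist_triangle_half_l)
      then have "dist ((f ^^ k) x) ((f ^^ k) y) < \<delta>" if "k < n" for k
        using d[of x y k] e[OF that] W(1) xy by auto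
      then show False using W(2) xy unfolding separated_set_def by force
    qed
    then show "finite W \<and> card W \<le> card C"
      using g C(1) by (meson card_inj_on_le image_subsetI inj_on_finite)
  qed
qed

lemma max_separated:
  fixes f :: "'a::metric_space \<Rightarrow> 'a"
  assumes X: "compact X" and f: "continuous_on X f" "f ` X \<subseteq> X" and \<delta>: "\<delta> > 0"
  shows "\<exists>W\<subseteq>X. finite W \<and> separated_set f n \<delta> W \<and> card W = max_separated X f n \<delta>"
    and "\<And>W. W \<subseteq> X \<Longrightarrow> separated_set f n \<delta> W \<Longrightarrow> finite W \<and> card W \<le> max_separated X f n \<delta>"
proof -
  obtain N where N: "\<And>W. W \<subseteq> X \<Longrightarrow> separated_set f n \<delta> W \<Longrightarrow> finite W \<and> card W \<le> N"
    using separated_set_bounded[OF assms, where n = n] by metis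
  let ?P = "\<lambda>s. \<exists>W\<subseteq>X. finite W \<and> separated_set f n \<delta> W \<and> card W = s"
  have P0: "?P 0" by (rule exI[of _ "{}"]) (simp add: separated_set_def)
  have b: "s \<le> N" if "?P s" for s using N that by metis
  show "?P (max_separated X f n \<delta>)"
    unfolding max_separated_def by (rule GreatestI_nat[where P = ?P and b = N, OF P0]) (use b in simp)
  show "finite W \<and> card W \<le> max_separated X f n \<delta>"
    if "W \<subseteq> X" "separated_set f n \<delta> W" for W
  proof
    show fin: "finite W" using N[OF that] by simp
    have "?P (card W)" by (intro exI[of _ W] conjI that fin refl)
    then show "card W \<le> max_separated X f n \<delta>"
      unfolding max_separated_def by (rule Greatest_le_nat[where P = ?P and b = N]) (use b in simp)
  qed
qed

section \<open>The torus \<open>\<real>\<^sup>2/\<int>\<^sup>2\<close>\<close>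

definition torus_rel :: "real \<times> real \<Rightarrow> real \<times> real \<Rightarrow> bool" where
  "torus_rel u v \<longleftrightarrow> fst u - fst v \<in> \<int> \<and> snd u - snd v \<in> \<int>"

lemma torus_rel_sym: "torus_rel u v \<Longrightarrow> torus_rel v u"
  unfolding torus_rel_def using Ints_minus by fastforce

lemma torus_rel_trans: "torus_rel u v \<Longrightarrow> torus_rel v w \<Longrightarrow> torus_rel u w"
  unfolding torus_rel_def
  using Ints_add[of "fst u - fst v" "fst v - fst w"] Ints_add[of "snd u - snd v" "snd v - snd w"]
  by simp

lemma equivp_torus_rel: "equivp torus_rel"
proof (rule equivpI)
  show "reflp torus_rel" by (auto simp: reflp_def torus_rel_def)
  show "symp torus_rel" using torus_rel_sym by (auto intro: sympI)
  show "transp torus_rel" using torus_rel_trans by (blast intro: transpI)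
qed

quotient_type torus = "real \<times> real" / torus_rel
  morphisms torus_rep torus_proj
  by (rule equivp_torus_rel)

lemma torus_proj_eq_iff: "torus_proj u = torus_proj v \<longleftrightarrow> torus_rel u v"
  by (rule torus.abs_eq_iff)

lemma torus_proj_surj: obtains u where "p = torus_proj u"
proof -
  have "\<exists>u. p = torus_proj u" by (induct p rule: torus.abs_induct) blast
  then show thesis using that by blast
qed

text \<open>The quotient metric: the Euclidean distance between the fibres of two points.\<close>

instantiation torus :: metric_space
begin

definition dist_torus :: "torus \<Rightarrow> torus \<Rightarrow> real" where
  "dist_torus p q = Inf {dist u v |u v. torus_proj u = p \<and> torus_proj v = q}"

definition uniformity_torus :: "(torus \<times> torus) filter" where
  "uniformity_torus = (INF e\<in>{0<..}. principal {(p, q). dist p q < e})"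

definition open_torus :: "torus set \<Rightarrow> bool" where
  "open_torus U \<longleftrightarrow> (\<forall>p\<in>U. eventually (\<lambda>(p', q). p' = p \<longrightarrow> q \<in> U) uniformity)"

lemma torus_dist_bdd_below:
  "bdd_below {dist u v |u v. torus_proj u = p \<and> torus_proj v = q}"
  by (rule bdd_belowI[of _ 0]) (elim CollectE exE conjE, simp)

lemma torus_dist_le: "dist (torus_proj u) (torus_proj v) \<le> dist u v"
  unfolding dist_torus_def by (rule cInf_lower[OF _ torus_dist_bdd_below]) blast

lemma torus_dist_nonneg: "0 \<le> dist p (q::torus)"
proof -
  obtain u v where "p = torus_proj u" "q = torus_proj v" by (metis torus_proj_surj)
  then have "{dist u v |u v. torus_proj u = p \<and> torus_proj v = q} \<noteq> {}" by blast
  then show ?thesis unfolding dist_torus_def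
    by (rule cInf_greatest) (elim CollectE exE conjE, simp)
qed

lemma torus_dist_commute: "dist p q = dist q (p::torus)"
proof -
  have "{dist u v |u v. torus_proj u = p \<and> torus_proj v = q}
      = {dist u v |u v. torus_proj u = q \<and> torus_proj v = p}"
    using dist_commute by blast
  then show ?thesis unfolding dist_torus_def by simp
qed

lemma torus_dist_lift:
  assumes "dist (torus_proj u) q < e"
  obtains v where "torus_proj v = q" "dist u v < e"
proof -
  let ?S = "{dist u' v |u' v. torus_proj u' = torus_proj u \<and> torus_proj v = q}"
  obtain w where "q = torus_proj w" by (rule torus_proj_surj)
  then have "?S \<noteq> {}" by blast
  then have "\<exists>x\<in>?S. x < e"
    using assms unfolding dist_torus_def by (rule cInf_lessD)
  then obtain u' v where *: "torus_proj u' = torus_proj u" "torus_proj v = q" "dist u' v < e"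
    by blast
  have "torus_rel u' u" using * torus_proj_eq_iff by blast
  then have "torus_rel (v + (u - u')) v"
    using torus_rel_sym[of u' u] by (simp add: torus_rel_def)
  then have "torus_proj (v + (u - u')) = q" using * torus_proj_eq_iff by metis
  moreover have "dist u (v + (u - u')) = dist u' v" by (simp add: dist_norm algebra_simps)
  ultimately show ?thesis using that *(3) by metis
qed

lemma torus_rel_close_eq:
  assumes "torus_rel u v" "dist u v < 1" shows "u = v"
proof -
  have "\<bar>fst u - fst v\<bar> < 1" "\<bar>snd u - snd v\<bar> < 1"
    using dist_fst_le[of u v] dist_snd_le[of u v] assms(2) by (auto simp: dist_real_def)
  then have "fst u - fst v = 0" "snd u - snd v = 0"
    using assms(1) Ints_nonzero_abs_less1 unfolding torus_rel_def by blast+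
  then show ?thesis by (simp add: prod_eq_iff)
qed

instance
proof
  show "uniformity = (INF e\<in>{0<..}. principal {(p::torus, q). dist p q < e})"
    by (rule uniformity_torus_def)
  show "open U = (\<forall>p\<in>U. eventually (\<lambda>(p', q). p' = p \<longrightarrow> q \<in> U) uniformity)" for U :: "torus set"
    by (rule open_torus_def)
  show "dist p q = 0 \<longleftrightarrow> p = q" for p q :: torus
  proof
    assume 0: "dist p q = 0"
    obtain u where u: "p = torus_proj u" by (rule torus_proj_surj)
    obtain v where v: "torus_proj v = q" "dist u v < 1/2"
      using torus_dist_lift[of u q "1/2"] 0 u by auto
    have "u = v"
    proof (rule ccontr)
      assume "u \<noteq> v"
      then obtain w where w: "torus_proj w = q" "dist u w < dist u v"
        using torus_dist_lift[of u q "dist u v"] 0 u by auto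
      have "dist v w < 1"
        using dist_triangle3[of v w u] v(2) w(2) by linarith
      moreover have "torus_rel v w" using v(1) w(1) torus_proj_eq_iff by metis
      ultimately have "v = w" using torus_rel_close_eq by metis
      then show False using w(2) by simp
    qed
    then show "p = q" using u v by simp
  next
    assume "p = q"
    then show "dist p q = 0"
      using torus_dist_le torus_dist_nonneg torus_proj_surj by (metis antisym dist_self)
  qed
  show "dist p q \<le> dist p r + dist q r" for p q r :: torus
  proof (rule field_le_epsilon)
    fix e :: real assume "e > 0"
    obtain u where u: "p = torus_proj u" by (rule torus_proj_surj)
    obtain w where w: "torus_proj w = r" "dist u w < dist p r + e/2"
      using torus_dist_lift[of u r "dist p r + e/2"] \<open>e > 0\<close> u by auto
    obtain v where v: "torus_proj v = q" "dist w v < dist q r + e/2"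
      using torus_dist_lift[of w q "dist q r + e/2"] \<open>e > 0\<close> w torus_dist_commute[of r q] by auto
    have "dist p q \<le> dist u v" using torus_dist_le u v by metis
    also have "\<dots> \<le> dist u w + dist w v" by (rule dist_triangle)
    finally show "dist p q \<le> dist p r + dist q r + e" using v w by simp
  qed
qed

end

lemma continuous_on_torus_proj: "continuous_on S torus_proj"
  unfolding continuous_on_iff by (meson torus_dist_le le_less_trans)

lemma compact_torus: "compact (UNIV :: torus set)"
proof -
  have "p \<in> torus_proj ` ({0..1} \<times> {0..1})" for p
  proof -
    obtain u where u: "p = torus_proj u" by (rule torus_proj_surj)
    have "torus_rel u (frac (fst u), frac (snd u))" by (simp add: torus_rel_def frac_def)
    then have "p = torus_proj (frac (fst u), frac (snd u))" using u torus_proj_eq_iff by simp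
    moreover have "(frac (fst u), frac (snd u)) \<in> {0..1} \<times> {0..1}"
      using frac_lt_1 less_imp_le by auto
    ultimately show ?thesis by blast
  qed
  then have "UNIV = torus_proj ` ({0..1} \<times> {0..1})" by blast
  then show ?thesis
    by (metis compact_Icc compact_Times compact_continuous_image continuous_on_torus_proj)
qed

section \<open>The standard map\<close>

text \<open>Reduction modulo 1 is the passage to the quotient: the lift below is compatible with
  \<open>torus_rel\<close> and hence descends to the torus.\<close>

definition standard_lift :: "real \<Rightarrow> real \<times> real \<Rightarrow> real \<times> real" where
  "standard_lift \<epsilon> = (\<lambda>(x, y).
     (x + y + \<epsilon> / (2 * pi) * sin (2 * pi * x), y + \<epsilon> / (2 * pi) * sin (2 * pi * x)))"

lemma standard_lift_respects:
  assumes "torus_rel u v" shows "torus_rel (standard_lift \<epsilon> u) (standard_lift \<epsilon> v)"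
proof -
  obtain x y x' y' where uv: "u = (x, y)" "v = (x', y')" by (cases u, cases v)
  obtain m n where mn: "x - x' = of_int m" "y - y' = of_int n"
    using assms uv by (auto simp: torus_rel_def elim!: Ints_cases)
  have "2 * pi * x = 2 * pi * x' + 2 * pi * of_int m"
    using mn(1) by (simp flip: mn(1) distrib_left)
  then have s: "sin (2 * pi * x) = sin (2 * pi * x')"
    using sin.plus_of_int[of "2 * pi * x'" m] by (simp add: mult.commute)
  have "(x + y) - (x' + y') = of_int (m + n)" using mn by simp
  then show ?thesis using s mn unfolding torus_rel_def standard_lift_def uv
    by (auto simp: algebra_simps)
qed

lift_definition standard_map :: "real \<Rightarrow> torus \<Rightarrow> torus" is standard_lift
  by (rule standard_lift_respects)

lemma continuous_on_standard_map: "continuous_on UNIV (standard_map \<epsilon>)"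
  unfolding continuous_on_iff
proof (intro ballI allI impI)
  fix p :: torus and e :: real assume "e > 0"
  obtain u where u: "p = torus_proj u" by (rule torus_proj_surj)
  have "continuous_on UNIV (standard_lift \<epsilon>)"
    unfolding standard_lift_def case_prod_beta by (intro continuous_intros)
  then obtain d where d: "d > 0"
    "\<And>v. dist v u < d \<Longrightarrow> dist (standard_lift \<epsilon> v) (standard_lift \<epsilon> u) < e"
    using \<open>e > 0\<close> unfolding continuous_on_iff by (metis UNIV_I)
  show "\<exists>d>0. \<forall>q\<in>UNIV. dist q p < d \<longrightarrow> dist (standard_map \<epsilon> q) (standard_map \<epsilon> p) < e"
  proof (intro exI[of _ d] conjI ballI impI)
    show "d > 0" by fact
    fix q assume "dist q p < d"
    then obtain v where v: "torus_proj v = q" "dist u v < d"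
      using torus_dist_lift[of u q d] u by (metis dist_commute)
    have "dist (standard_map \<epsilon> q) (standard_map \<epsilon> p)
        \<le> dist (standard_lift \<epsilon> v) (standard_lift \<epsilon> u)"
      using torus_dist_le u v(1) standard_map.abs_eq by metis
    also have "\<dots> < e" using d(2)[of v] v(2) dist_commute[of u v] by simp
    finally show "dist (standard_map \<epsilon> q) (standard_map \<epsilon> p) < e" .
  qed
qed

end

theory Submission
  imports Defs
begin

text \<open>The entropy is bounded below by counting orbits in a horseshoe with five branches. In the angle
  \<open>\<theta> = 2 * pi * x\<close> the orbits are the sequences with
  \<open>\<theta>\<^bsub>n+1\<^esub> + \<theta>\<^bsub>n-1\<^esub> = 2 * \<theta>\<^bsub>n\<^esub> + 2 * sin \<theta>\<^bsub>n\<^esub>\<close>, and the origin is a hyperbolic fixed point. Around it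
  lies a curved quadrilateral, the \<open>window\<close>, and the objects that are iterated are arcs
  which cross the window along the unstable direction.

  A crossing arc contains a sub-arc whose image crosses the window again after one step (\<open>crossing_stay\<close>). Its ends
  are pushed away from the origin, and they meet the stable manifold of the neighbouring copies of the fixed point:
  the part of the arc that moves once around the torus in the positive direction returns, four steps later, to the
  copy of the window at \<open>(2 * pi, 2 * pi)\<close>, and it sweeps across that copy twice, first upwards and then
  downwards, near two different homoclinic orbits (\<open>crossing_first\<close>, \<open>crossing_second\<close>). By symmetry the same happens
  in the negative direction. So each crossing arc contains one sub-arc that crosses again after one step and four that
  cross again after four steps, and these five are told apart, modulo \<open>2 * pi\<close>, by the first two angles
  (\<open>pieces_apart\<close>).

  The number \<open>N n\<close> of separated orbits of length \<open>n\<close> therefore satisfies \<open>N (n + 4) = N (n + 3) + 4 * N n\<close>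
  (\<open>separated_orbits\<close>), which grows like the powers of the root \<open>1.7484...\<close> of \<open>\<lambda>^4 = \<lambda>^3 + 4\<close>. Its logarithm is
  \<open>0.5587...\<close>, which leaves room to work with the rate \<open>1.74\<close> and with coarse numerical bounds.

  The crossing argument is one-dimensional: sub-arcs are cut out by intermediate values (\<open>arc_between\<close>), and all that
  has to be known about the map are inequalities which say that the ends of a sub-arc land on opposite sides of the
  window (\<open>landing_low_first\<close>, \<open>landing_high\<close>, \<open>landing_low_second\<close>) and that between these ends the image does not leave the
  window through its other two sides (\<open>landing\<close>). Since \<open>2 * \<theta> + 2 * sin \<theta>\<close> is monotone, these follow from its values at
  finitely many rational points.\<close>

section \<open>The standard map as a second order recurrence\<close>

text \<open>In the angle \<open>\<theta> = 2 * pi * x\<close> an orbit of the standard map with parameter 2 is a sequence with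
  \<open>\<theta>\<^bsub>n+1\<^esub> + \<theta>\<^bsub>n-1\<^esub> = nbr_sum \<theta>\<^bsub>n\<^esub>\<close>. The parameter 2 is the largest one for which the right-hand side is
  monotone, and monotonicity is what turns all estimates below into evaluations at single points.\<close>

definition nbr_sum :: "real \<Rightarrow> real" where "nbr_sum \<theta> = 2 * \<theta> + 2 * sin \<theta>"

definition advance :: "real \<times> real \<Rightarrow> real \<times> real" where
  "advance = (\<lambda>(u, v). (v, nbr_sum v - u))"

lemma mono_nbr_sum: "x \<le> y \<Longrightarrow> nbr_sum x \<le> nbr_sum y"
  by (rule DERIV_nonneg_imp_nondecreasing[of x y nbr_sum])
     (auto simp: nbr_sum_def[abs_def] intro!: derivative_eq_intros exI cos_ge_minus_one,
      smt (verit) cos_ge_minus_one)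

lemma nbr_sum_less_imp_less: "nbr_sum x < nbr_sum y \<Longrightarrow> x < y"
  using mono_nbr_sum[of y x] by linarith

lemma nbr_sum_zero [simp]: "nbr_sum 0 = 0" by (simp add: nbr_sum_def)

lemma nbr_sum_uminus: "nbr_sum (- x) = - nbr_sum x" by (simp add: nbr_sum_def)

lemma nbr_sum_pos_imp_pos: "0 < v" if "0 < nbr_sum v"
  using nbr_sum_less_imp_less[of 0 v] that by simp

lemma nbr_sum_le_quadruple: "0 \<le> x \<Longrightarrow> nbr_sum x \<le> 4 * x"
  using sin_x_le_x[of x] by (simp add: nbr_sum_def)

lemma nbr_sum_plus_2pi: "nbr_sum (x + 2 * pi) = nbr_sum x + 4 * pi"
  using sin_periodic[of x] by (simp add: nbr_sum_def algebra_simps)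

lemma continuous_on_nbr_sum [continuous_intros]:
  fixes f :: "'a::t2_space \<Rightarrow> real"
  shows "continuous_on S f \<Longrightarrow> continuous_on S (\<lambda>x. nbr_sum (f x))"
  unfolding nbr_sum_def by (intro continuous_intros)

lemma continuous_on_advance_pow:
  fixes f :: "'a::t2_space \<Rightarrow> real \<times> real"
  shows "continuous_on S f \<Longrightarrow> continuous_on S (\<lambda>x. (advance ^^ n) (f x))"
proof (induction n)
  case (Suc n)
  then show ?case by (auto simp: advance_def case_prod_beta intro!: continuous_intros)
qed simp

lemma advance_uminus: "advance (- p) = - advance p"
  by (simp add: advance_def case_prod_beta nbr_sum_uminus uminus_prod_def)

lemma advance_pow_uminus: "(advance ^^ n) (- p) = - (advance ^^ n) p"
  by (induction n) (auto simp: advance_uminus)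

lemma nbr_sum_taylor:
  "\<bar>nbr_sum x - (4 * x - x^3 / 3 + x^5 / 60 - x^7 / 2520 + x^9 / 181440)\<bar> \<le> \<bar>x\<bar>^11 / 19958400"
proof -
  have "(\<Sum>m<11. sin_coeff m * x^m) = x - x^3 / 6 + x^5 / 120 - x^7 / 5040 + x^9 / 362880"
  proof -
    have "{..<11::nat} = {0, 1, 2, 3, 4, 5, 6, 7, 8, 9, 10}"
      by (simp add: lessThan_nat_numeral lessThan_Suc insert_commute)
    then show ?thesis by (simp add: sin_coeff_def fact_numeral)
  qed
  moreover have "inverse (fact 11) = inverse (39916800 :: real)"
    by (simp add: fact_numeral)
  ultimately have "\<bar>sin x - (x - x^3 / 6 + x^5 / 120 - x^7 / 5040 + x^9 / 362880)\<bar> \<le> \<bar>x\<bar>^11 / 39916800"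
    using Maclaurin_sin_bound[of x 11] by (simp only: divide_inverse mult_1 mult.commute)
  then show ?thesis unfolding nbr_sum_def abs_le_iff by linarith
qed

text \<open>With \<open>y\<close> and \<open>x\<close> rational numerals, the premises are settled by rational arithmetic; the same holds
  for the other bounds of this form.\<close>

lemma nbr_sum_ge:
  assumes "0 \<le> x" "y \<le> 4 * x - x^3 / 3 + x^5 / 60 - x^7 / 2520 + x^9 / 181440 - x^11 / 19958400"
  shows "y \<le> nbr_sum x"
proof -
  have "\<bar>x\<bar> = x" using assms(1) by simp
  then show ?thesis using nbr_sum_taylor[of x] assms(2) unfolding abs_le_iff by linarith
qed

lemma nbr_sum_le:
  assumes "0 \<le> x" "4 * x - x^3 / 3 + x^5 / 60 - x^7 / 2520 + x^9 / 181440 + x^11 / 19958400 \<le> y"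
  shows "nbr_sum x \<le> y"
proof -
  have "\<bar>x\<bar> = x" using assms(1) by simp
  then show ?thesis using nbr_sum_taylor[of x] assms(2) unfolding abs_le_iff by linarith
qed

text \<open>The deviation of \<open>nbr_sum\<close> from its value at its critical point:
  \<open>nbr_sum (pi - z) = 2 * pi - defect z\<close>. It is of third order in \<open>z\<close>, so near angle
  \<open>pi\<close> the map is almost the rotation \<open>(u, v) \<mapsto> (v, 2 * pi - u)\<close>.\<close>

definition defect :: "real \<Rightarrow> real" where "defect z = 2 * (z - sin z)"

lemma mono_defect: "x \<le> y \<Longrightarrow> defect x \<le> defect y"
  by (rule DERIV_nonneg_imp_nondecreasing[of x y defect])
     (auto simp: defect_def[abs_def] intro!: derivative_eq_intros)

lemma defect_nbr_sum: "defect z = 4 * z - nbr_sum z"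
  by (simp add: defect_def nbr_sum_def)

lemma defect_lower:
  assumes "0 \<le> a" "4 * a - a^3 / 3 + a^5 / 60 - a^7 / 2520 + a^9 / 181440 + a^11 / 19958400 \<le> 4 * a - y"
  shows "y \<le> defect a"
  using nbr_sum_le[OF assms] by (simp add: defect_nbr_sum)

lemma defect_upper:
  assumes "0 \<le> a" "4 * a - y \<le> 4 * a - a^3 / 3 + a^5 / 60 - a^7 / 2520 + a^9 / 181440 - a^11 / 19958400"
  shows "defect a \<le> y"
  using nbr_sum_ge[OF assms] by (simp add: defect_nbr_sum)

lemma pi_bounds: "3.1415 \<le> pi" "pi \<le> 3.1416"
  using pi_approx by (simp_all)

section \<open>Arcs that cross the window\<close>

text \<open>The two-function form of cutting an arc: it ends where \<open>f\<close> comes up to \<open>l\<close> and where \<open>g\<close> comes up to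
  \<open>h\<close>, in either order along the parameter. With \<open>f = g\<close> this cuts out the part between two levels of one function.\<close>

lemma arc_between:
  fixes f g :: "real \<Rightarrow> real"
  assumes f: "continuous_on {a..b} f" and g: "continuous_on {a..b} g"
    and s: "s \<in> {a..b}" "f s \<le> l" and t: "t \<in> {a..b}" "h \<le> g t"
    and disj: "\<And>r. r \<in> {a..b} \<Longrightarrow> f r \<le> l \<Longrightarrow> g r < h"
  obtains a' b' where "{a'..b'} \<subseteq> {a..b}" "\<And>r. r \<in> {a'..b'} \<Longrightarrow> l \<le> f r \<and> g r \<le> h"
    "\<exists>r\<in>{a'..b'}. f r = l" "\<exists>r\<in>{a'..b'}. g r = h"
proof -
  \<comment> \<open>A closest pair of points of the two closed sets bounds an interval that meets neither set inside.\<close>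
  define A where "A = {r \<in> {a..b}. f r \<le> l}"
  define D where "D = {r \<in> {a..b}. h \<le> g r}"
  have "closed A" "closed D"
    unfolding A_def D_def
    by (rule continuous_on_closed_Collect_le[OF f continuous_on_const closed_atLeastAtMost],
        rule continuous_on_closed_Collect_le[OF continuous_on_const g closed_atLeastAtMost])
  then have "compact A" "compact D"
    by (auto simp: compact_eq_bounded_closed A_def D_def intro: bounded_subset[of "{a..b}"])
  then have "compact (A \<times> D)" by (rule compact_Times)
  moreover have "A \<times> D \<noteq> {}" using s t by (auto simp: A_def D_def)
  moreover have "continuous_on (A \<times> D) (\<lambda>p. \<bar>fst p - snd p\<bar>)"
    by (intro continuous_intros)
  ultimately obtain p where p: "p \<in> A \<times> D" "\<forall>q\<in>A \<times> D. \<bar>fst p - snd p\<bar> \<le> \<bar>fst q - snd q\<bar>"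
    using continuous_attains_inf[of "A \<times> D" "\<lambda>p. \<bar>fst p - snd p\<bar>"] by blast
  define s0 t0 where "s0 = fst p" and "t0 = snd p"
  have st: "s0 \<in> A" "t0 \<in> D" and least: "\<And>x y. x \<in> A \<Longrightarrow> y \<in> D \<Longrightarrow> \<bar>s0 - t0\<bar> \<le> \<bar>x - y\<bar>"
    using p by (auto simp: s0_def t0_def)
  define a' b' where "a' = min s0 t0" and "b' = max s0 t0"
  have "s0 \<noteq> t0" using st disj by (force simp: A_def D_def)
  then have ab: "a' < b'" by (auto simp: a'_def b'_def)
  have sub: "{a'..b'} \<subseteq> {a..b}" using st by (auto simp: a'_def b'_def A_def D_def)
  have cl: "closure {a'<..<b'} = {a'..b'}" using ab by simp
  have int: "r \<notin> A \<and> r \<notin> D" if "r \<in> {a'<..<b'}" for r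
    using least[of r t0] least[of s0 r] st that by (auto simp: a'_def b'_def min_def max_def split: if_splits)
  have "l \<le> f r \<and> g r \<le> h" if "r \<in> {a'..b'}" for r
  proof
    show "l \<le> f r"
      by (rule continuous_ge_on_closure[of "{a'<..<b'}" f r l])
         (use that cl int sub f in \<open>auto simp: A_def intro: continuous_on_subset less_imp_le\<close>, force)
    show "g r \<le> h"
      by (rule continuous_le_on_closure[of "{a'<..<b'}" g r h])
         (use that cl int sub g in \<open>auto simp: D_def intro: continuous_on_subset less_imp_le\<close>, force)
  qed
  moreover have "s0 \<in> {a'..b'}" "t0 \<in> {a'..b'}" by (auto simp: a'_def b'_def)
  moreover have "f s0 \<le> l" "h \<le> g t0" using st by (auto simp: A_def D_def)
  ultimately show thesis using that[of a' b'] ab sub by (meson antisym less_imp_le)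
qed

text \<open>A pair \<open>(u, v)\<close> stands for two consecutive angles. The second condition bounds the angle \<open>nbr_sum u - v\<close>
  that precedes \<open>u\<close>. It confines the window to a strip around the unstable direction of
  the fixed point at the origin; bounding an earlier angle and not \<open>u\<close> turns the condition at the end of an
  excursion into a bound on an angle that is already known.\<close>

definition window :: "(real \<times> real) set" where
  "window = {(u, v). \<bar>v\<bar> \<le> 1.1 \<and> \<bar>nbr_sum u - v\<bar> \<le> 2.2}"

lemma window_iff:
  "(u, v) \<in> window \<longleftrightarrow> - 1.1 \<le> v \<and> v \<le> 1.1 \<and> v - 2.2 \<le> nbr_sum u \<and> nbr_sum u \<le> v + 2.2"
  unfolding window_def mem_Collect_eq prod.case abs_le_iff by (intro iffI conjI; linarith)

lemma window_abs_fst: "\<bar>u\<bar> \<le> 0.9" if "(u, v) \<in> window"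
proof -
  have "3.3 < nbr_sum 0.9" by (rule less_le_trans[OF _ nbr_sum_ge[OF _ order_refl]]; simp add: power_divide)
  moreover have "nbr_sum u \<le> 3.3" "nbr_sum (- u) \<le> 3.3" using that unfolding window_iff nbr_sum_uminus by linarith+
  ultimately have "nbr_sum u < nbr_sum 0.9" "nbr_sum (- u) < nbr_sum 0.9" by linarith+
  then have "u < 0.9" "- u < 0.9" by (blast intro: nbr_sum_less_imp_less)+
  then show ?thesis by simp
qed

text \<open>No orientation is prescribed, so that an excursion which reverses the direction of an arc needs no
  separate treatment.\<close>

definition crossing :: "(real \<Rightarrow> real \<times> real) \<Rightarrow> real \<Rightarrow> real \<Rightarrow> bool" where
  "crossing \<gamma> a b \<longleftrightarrow> continuous_on {a..b} \<gamma> \<and> \<gamma> ` {a..b} \<subseteq> window \<and>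
     (\<exists>t\<in>{a..b}. snd (\<gamma> t) = - 1.1) \<and> (\<exists>t\<in>{a..b}. snd (\<gamma> t) = 1.1)"

lemma crossing_uminus:
  assumes "crossing \<gamma> a b" shows "crossing (\<lambda>t. - \<gamma> t) a b"
  unfolding crossing_def
proof (intro conjI image_subsetI)
  have cont: "continuous_on {a..b} \<gamma>" and win: "\<gamma> ` {a..b} \<subseteq> window"
    using assms by (simp_all add: crossing_def)
  obtain s t where st: "s \<in> {a..b}" "snd (\<gamma> s) = - 1.1" "t \<in> {a..b}" "snd (\<gamma> t) = 1.1"
    using assms unfolding crossing_def by blast
  show "continuous_on {a..b} (\<lambda>t. - \<gamma> t)" by (rule continuous_on_minus[OF cont])
  show "- \<gamma> r \<in> window" if "r \<in> {a..b}" for r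
  proof -
    have "\<gamma> r \<in> window" using win that by blast
    then show ?thesis by (cases "\<gamma> r") (simp add: window_iff nbr_sum_uminus)
  qed
  show "\<exists>t\<in>{a..b}. snd (- \<gamma> t) = - 1.1" using st(3,4) by (intro bexI[of _ t]) simp_all
  show "\<exists>t\<in>{a..b}. snd (- \<gamma> t) = 1.1" using st(1,2) by (intro bexI[of _ s]) simp_all
qed

section \<open>Estimates along an excursion\<close>

text \<open>The bound \<open>1.18\<close> on the next angle is what distinguishes an excursion in the positive direction from a
  point that stays in the window.\<close>

lemma excursion_start_bounds:
  assumes w: "(u, v) \<in> window" and x2: "1.18 \<le> nbr_sum v - u"
  shows "0.07 \<le> v" "v \<le> 1.1" "-0.57 \<le> u" "u \<le> 0.9"
proof -
  show "v \<le> 1.1" using w unfolding window_iff by simp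
  have u: "\<bar>u\<bar> \<le> 0.9" by (rule window_abs_fst[OF w])
  then show "u \<le> 0.9" by simp
  have "0.28 \<le> nbr_sum v" using x2 u by simp
  moreover from this have "0 < v" using nbr_sum_pos_imp_pos[of v] by simp
  ultimately show "0.07 \<le> v" using nbr_sum_le_quadruple[of v] by simp
  have "2.2 \<le> nbr_sum 0.57" by (rule nbr_sum_ge; simp add: power_divide)
  moreover have "nbr_sum (-u) < 2.2" using w \<open>0 < v\<close> unfolding window_iff nbr_sum_uminus by linarith
  ultimately have "nbr_sum (- u) < nbr_sum 0.57" by linarith
  then have "- u < 0.57" by (rule nbr_sum_less_imp_less)
  then show "-0.57 \<le> u" by simp
qed

text \<open>Everything about an excursion is expressed by \<open>z = pi - \<theta>\<^bsub>2\<^esub>\<close> and \<open>X = 2 * pi - \<theta>\<^bsub>3\<^esub>\<close>, where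
  \<open>(u, v) = (\<theta>\<^bsub>0\<^esub>, \<theta>\<^bsub>1\<^esub>)\<close>; subtracting \<open>2 * pi\<close> moves the arrival point back to the window at the origin.\<close>

lemma advance4:
  assumes "nbr_sum v - u = pi - z" "X = v + defect z"
  shows "(advance ^^ 4) (u, v) - (2 * pi, 2 * pi) =
     (pi + z - nbr_sum X, nbr_sum (pi + z - nbr_sum X) + X)"
proof -
  have x3: "nbr_sum (pi - z) - v = - X + 2 * pi"
    by (simp add: assms(2) defect_def nbr_sum_def)
  have x4: "nbr_sum (- X + 2 * pi) - (pi - z) = (pi + z - nbr_sum X) + 2 * pi"
    unfolding nbr_sum_plus_2pi nbr_sum_uminus by simp
  have "(advance ^^ 4) (u, v) = advance (advance (pi - z, nbr_sum (pi - z) - v))"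
    by (simp add: advance_def eval_nat_numeral assms(1))
  also have "\<dots> = advance (- X + 2 * pi, (pi + z - nbr_sum X) + 2 * pi)"
    unfolding x3 by (simp only: advance_def prod.case x4)
  finally show ?thesis by (simp only: advance_def prod.case nbr_sum_plus_2pi) simp
qed

lemma approach_bounds:
  assumes w: "(u, v) \<in> window" and x2: "nbr_sum v - u = pi - z" and z: "-0.7 \<le> z" "z \<le> 1.96"
  shows "-2.2 \<le> v + defect z" "v + defect z \<le> 2.9"
proof -
  have x2': "1.18 \<le> nbr_sum v - u" using x2 z pi_bounds by simp
  note wf = excursion_start_bounds[OF w x2']
  have "defect 0.7 \<le> 0.2" by (rule defect_upper; simp add: power_divide)
  then have "-0.2 \<le> defect (-0.7)" by (simp add: defect_def)
  then show "-2.2 \<le> v + defect z" using mono_defect[OF z(1)] wf by simp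
  show "v + defect z \<le> 2.9"
  proof (cases "z \<le> 1.2")
    case True
    have "defect 1.2 \<le> 0.6" by (rule defect_upper; simp add: power_divide)
    then show ?thesis using mono_defect[OF True] wf by simp
  next
    case False
    have "nbr_sum v \<le> 2.85" using x2 False wf pi_bounds by simp
    moreover have "2.855 \<le> nbr_sum 0.75" by (rule nbr_sum_ge; simp add: power_divide)
    ultimately have "nbr_sum v < nbr_sum 0.75" by simp
    then have "v < 0.75" by (rule nbr_sum_less_imp_less)
    moreover have "defect 1.96 \<le> 2.1" by (rule defect_upper; simp add: power_divide)
    ultimately show ?thesis using mono_defect[OF z(2)] by simp
  qed
qed

text \<open>Arrivals with \<open>X\<close> above \<open>2.2\<close>, which would violate the strip condition of the window, pass below it.
  The constant \<open>5.1016\<close> is the bound \<open>3.1416 + 1.96\<close> on \<open>pi + z\<close>.\<close>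

lemma overshoot:
  assumes X: "2.2 \<le> X" "X \<le> 2.9" and s: "s \<le> 5.1016"
  shows "X + 1.1 < nbr_sum (nbr_sum X - s)"
proof -
  \<comment> \<open>Monotonicity reduces the claim on an interval to one composite evaluation at its left end, provided that
     the interval is short; four intervals suffice.\<close>
  have *: "X + 1.1 < nbr_sum (nbr_sum X - s)"
    if "y \<le> nbr_sum x" "w \<le> nbr_sum (y - 5.1016)" "x \<le> X" "X \<le> b" "b + 1.1 < w" for x y b w
  proof -
    have "y - 5.1016 \<le> nbr_sum X - s" using mono_nbr_sum[OF that(3)] that(1) s by linarith
    then show ?thesis using mono_nbr_sum[of "y - 5.1016" "nbr_sum X - s"] that by linarith
  qed
  have v: "6.016 \<le> nbr_sum 2.2" "6.084 \<le> nbr_sum 2.29" "6.15 \<le> nbr_sum 2.4" "6.229 \<le> nbr_sum 2.6"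
    by (rule nbr_sum_ge; simp add: power_divide)+
  have w: "3.391 \<le> nbr_sum (6.016 - 5.1016)" "3.501 \<le> nbr_sum (6.084 - 5.1016)"
     "3.701 \<le> nbr_sum (6.15 - 5.1016)" "4.001 \<le> nbr_sum (6.229 - 5.1016)"
    by (rule nbr_sum_ge; simp add: power_divide)+
  consider "X \<le> 2.29" | "2.29 \<le> X" "X \<le> 2.4" | "2.4 \<le> X" "X \<le> 2.6" | "2.6 \<le> X"
    by linarith
  then show ?thesis
  proof cases
    case 1 show ?thesis by (rule *[OF v(1) w(1) X(1) 1]) simp
  next
    case 2 show ?thesis by (rule *[OF v(2) w(2) 2]) simp
  next
    case 3 show ?thesis by (rule *[OF v(3) w(3) 3]) simp
  next
    case 4 show ?thesis by (rule *[OF v(4) w(4) 4 X(2)]) simp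
  qed
qed

text \<open>An arrival whose second angle is in range lies in the window: its predecessor is \<open>- X\<close>, so the strip
  condition reads \<open>\<bar>X\<bar> \<le> 2.2\<close>, and too large an \<open>X\<close> would overshoot.\<close>

lemma landing:
  assumes w: "(u, v) \<in> window" and x2: "nbr_sum v - u = pi - z" and z: "-0.7 \<le> z" "z \<le> 1.96"
    and land: "(u', v') = (advance ^^ 4) (u, v) - (2 * pi, 2 * pi)" "\<bar>v'\<bar> \<le> 1.1"
  shows "(u', v') \<in> window"
proof -
  define X where "X = v + defect z"
  have *: "u' = pi + z - nbr_sum X" "v' = nbr_sum u' + X"
    using land(1) advance4[OF x2 X_def] by auto
  have "\<not> 2.2 < X"
  proof
    assume "2.2 < X"
    then have "X + 1.1 < nbr_sum (nbr_sum X - (pi + z))"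
      using approach_bounds[OF w x2 z] z pi_bounds by (intro overshoot) (auto simp: X_def)
    then have "v' < - 1.1" using * nbr_sum_uminus[of u'] by simp
    then show False using land(2) by simp
  qed
  moreover have "- 2.2 \<le> X" using approach_bounds[OF w x2 z] by (simp add: X_def)
  moreover have "- 1.1 \<le> v'" "v' \<le> 1.1" using land(2) by auto
  ultimately show ?thesis using * unfolding window_iff by linarith
qed

text \<open>The three lemmas \<open>landing_low_first\<close>, \<open>landing_high\<close> and \<open>landing_low_second\<close> say that, as \<open>\<theta>\<^bsub>2\<^esub>\<close>
  grows, the arrival starts below the window, gets above it and ends below it.\<close>

lemma landing_low_first:
  assumes w: "(u, v) \<in> window" and x2: "nbr_sum v - u = pi - 1.96"
    and land: "(u', v') = (advance ^^ 4) (u, v) - (2 * pi, 2 * pi)"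
  shows "v' \<le> - 1.1"
proof -
  define X where "X = v + defect 1.96"
  have *: "u' = pi + 1.96 - nbr_sum X" "v' = nbr_sum u' + X"
    using land(1) advance4[OF x2 X_def] by auto
  have "1.18 \<le> nbr_sum v - u" using x2 pi_bounds by simp
  note wf = excursion_start_bounds[OF w this]
  \<comment> \<open>\<open>X\<close> has reached the limit of the strip condition, where arrivals overshoot the window.\<close>
  have "0.61 \<le> nbr_sum v" using x2 wf pi_bounds by simp
  moreover from this have "0 < v" using nbr_sum_pos_imp_pos[of v] by simp
  ultimately have "0.15 \<le> v" using nbr_sum_le_quadruple[of v] by simp
  moreover have "2.05 \<le> defect 1.96" by (rule defect_lower; simp add: power_divide)
  ultimately have "2.2 \<le> X" by (simp add: X_def)
  then have "X + 1.1 < nbr_sum (nbr_sum X - (pi + 1.96))"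
    using approach_bounds[OF w x2] pi_bounds by (intro overshoot) (auto simp: X_def)
  then show ?thesis using * nbr_sum_uminus[of u'] by simp
qed

lemma landing_high:
  assumes w: "(u, v) \<in> window" and x2: "nbr_sum v - u = pi - z" and z: "0.8 \<le> z" "z \<le> 0.85"
    and land: "(u', v') = (advance ^^ 4) (u, v) - (2 * pi, 2 * pi)"
  shows "1.1 \<le> v'"
proof -
  define X where "X = v + defect z"
  have *: "u' = pi + z - nbr_sum X" "v' = nbr_sum u' + X"
    using land(1) advance4[OF x2 X_def] by auto
  have "1.18 \<le> nbr_sum v - u" using x2 z pi_bounds by simp
  note wf = excursion_start_bounds[OF w this]
  \<comment> \<open>Upper bounds on \<open>u\<close> and \<open>v\<close> sharpen each other, because the strip condition ties \<open>u\<close> to \<open>v\<close>.\<close>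
  have v1: "v < 0.87"
  proof (rule nbr_sum_less_imp_less)
    have "3.26 \<le> nbr_sum 0.87" by (rule nbr_sum_ge; simp add: power_divide)
    then show "nbr_sum v < nbr_sum 0.87" using x2 z wf pi_bounds by simp
  qed
  have u1: "u < 0.82"
  proof (rule nbr_sum_less_imp_less)
    have "3.09 \<le> nbr_sum 0.82" by (rule nbr_sum_ge; simp add: power_divide)
    then show "nbr_sum u < nbr_sum 0.82" using w v1 unfolding window_iff by auto
  qed
  have v2: "v < 0.84"
  proof (rule nbr_sum_less_imp_less)
    have "3.165 \<le> nbr_sum 0.84" by (rule nbr_sum_ge; simp add: power_divide)
    then show "nbr_sum v < nbr_sum 0.84" using x2 z u1 pi_bounds by simp
  qed
  have v3: "0.43 \<le> v" using nbr_sum_le_quadruple[of v] wf x2 z pi_bounds by simp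
  have m1: "0.163 \<le> defect 0.8" by (rule defect_lower; simp add: power_divide)
  have m2: "defect 0.85 \<le> 0.2" by (rule defect_upper; simp add: power_divide)
  have X1: "0.593 \<le> X" using m1 v3 mono_defect[OF z(1)] by (simp add: X_def)
  have "X \<le> 1.04" using m2 v2 mono_defect[OF z(2)] by (simp add: X_def)
  moreover have "nbr_sum 1.04 \<le> 3.807" by (rule nbr_sum_le; simp add: power_divide)
  ultimately have "nbr_sum X \<le> 3.807" using mono_nbr_sum by (meson order_trans)
  then have "nbr_sum 0.13 \<le> nbr_sum u'" using * z pi_bounds by (intro mono_nbr_sum) simp
  moreover have "0.51 \<le> nbr_sum 0.13" by (rule nbr_sum_ge; simp add: power_divide)
  ultimately show ?thesis using * X1 by simp
qed

text \<open>The end of the second arc is a level of \<open>nbr_sum v - z\<close> and not of \<open>z\<close>: on that level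
  \<open>pi + z - nbr_sum X\<close>, the first angle on arrival, equals \<open>pi - 3.9\<close> up to the small term
  \<open>nbr_sum v - nbr_sum X\<close>, whereas \<open>z\<close> alone does not determine it closely enough.\<close>

lemma landing_low_second:
  assumes w: "(u, v) \<in> window" and x2: "nbr_sum v - u = pi - z" and z: "z \<le> 0.8" "nbr_sum v - z = 3.9"
    and land: "(u', v') = (advance ^^ 4) (u, v) - (2 * pi, 2 * pi)"
  shows "v' \<le> - 1.1"
proof -
  define X where "X = v + defect z"
  have *: "u' = pi + z - nbr_sum X" "v' = nbr_sum u' + X"
    using land(1) advance4[OF x2 X_def] by auto
  have "1.18 \<le> nbr_sum v - u" using x2 z pi_bounds by simp
  note wf = excursion_start_bounds[OF w this]
  \<comment> \<open>As above, one round of mutual improvement between the bounds on \<open>u\<close>, \<open>v\<close> and \<open>z\<close>.\<close>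
  have v1: "0.855 < v"
  proof (rule nbr_sum_less_imp_less)
    have "nbr_sum 0.855 \<le> 3.225"  by (rule nbr_sum_le; simp add: power_divide)
    then show "nbr_sum 0.855 < nbr_sum v" using x2 z wf pi_bounds by simp
  qed
  have u1: "-0.345 < u"
  proof -
    have "1.35 \<le> nbr_sum 0.345" by (rule nbr_sum_ge; simp add: power_divide)
    then have "nbr_sum (-u) < nbr_sum 0.345" using w v1 unfolding window_iff nbr_sum_uminus by auto
    from nbr_sum_less_imp_less[OF this] show ?thesis by simp
  qed
  have zb: "-0.552 \<le> z" "z \<le> 0.0709" using x2 z u1 wf pi_bounds by auto
  have u': "u' = pi - 3.9 + (nbr_sum v - nbr_sum X)" using * z by simp
  have low: ?thesis if "u' \<le> - d" "X \<le> b" "b + 1.1 \<le> nbr_sum d" for d b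
    using that * mono_nbr_sum[of u' "-d"] by (simp add: nbr_sum_uminus)
  \<comment> \<open>\<open>nbr_sum\<close> has Lipschitz constant 4, since \<open>defect\<close> is monotone.\<close>
  have lip: "X \<le> v" "nbr_sum v - nbr_sum X \<le> 4 * defect (- z)" if "z \<le> 0"
  proof -
    have "defect z = - defect (- z)" by (simp add: defect_def)
    moreover have "0 \<le> defect (- z)" using mono_defect[of 0 "- z"] that by (simp add: defect_def)
    ultimately show "X \<le> v" by (simp add: X_def)
    then show "nbr_sum v - nbr_sum X \<le> 4 * defect (- z)"
      using mono_defect[of X v] \<open>defect z = - defect (- z)\<close> by (simp add: defect_nbr_sum X_def)
  qed
  consider "0 \<le> z" | "-0.4 \<le> z" "z \<le> 0" | "z \<le> -0.4" by linarith
  then show ?thesis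
  proof cases
    case 1
    have "0 \<le> defect z" using mono_defect[OF 1] by (simp add: defect_def)
    then have "nbr_sum v \<le> nbr_sum X" by (intro mono_nbr_sum) (simp add: X_def)
    moreover have "defect 0.0709 \<le> 0.1" by (rule defect_upper; simp add: power_divide)
    ultimately have "u' \<le> - 0.75" "X \<le> 1.2"
      using u' pi_bounds mono_defect[OF zb(2)] wf by (auto simp: X_def)
    moreover have "2.3 \<le> nbr_sum 0.75" by (rule nbr_sum_ge; simp add: power_divide)
    ultimately show ?thesis by (intro low[of "0.75" "1.2"]) auto
  next
    case 2
    have "defect 0.4 \<le> 0.0225" by (rule defect_upper; simp add: power_divide)
    moreover have "defect (- z) \<le> defect 0.4" using 2 by (intro mono_defect) simp
    ultimately have u'': "u' \<le> - 0.66" using lip 2 u' pi_bounds by simp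
    have "2.2 \<le> nbr_sum 0.66" by (rule nbr_sum_ge; simp add: power_divide)
    with u'' show ?thesis using lip(1) 2 wf by (intro low[of "0.66" "1.1"]) auto
  next
    case 3
    have "v < 0.945"
    proof (rule nbr_sum_less_imp_less)
      have "3.505 \<le> nbr_sum 0.945" by (rule nbr_sum_ge; simp add: power_divide)
      then show "nbr_sum v < nbr_sum 0.945" using z 3 by simp
    qed
    have "defect 0.552 \<le> 0.0565" by (rule defect_upper; simp add: power_divide)
    moreover have "defect (- z) \<le> defect 0.552" using zb by (intro mono_defect) simp
    ultimately have u'': "u' \<le> - 0.53" using lip 3 u' pi_bounds by simp
    have "2.045 \<le> nbr_sum 0.53" by (rule nbr_sum_ge; simp add: power_divide)
    with u'' \<open>v < 0.945\<close> show ?thesis using lip(1) 3 by (intro low[of "0.53" "0.945"]) auto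
  qed
qed

section \<open>Five sub-arcs of a crossing arc\<close>

text \<open>Piece 0 contains the points that stay in the window for one step, pieces 1 and 2 the points that start the
  upward and the downward half of an excursion; their negatives are pieces \<open>- 1\<close> and \<open>- 2\<close>.\<close>

definition piece :: "int \<Rightarrow> (real \<times> real) set" where
  "piece i = {p. snd p \<in> {- 1.1..1.1} \<and>
     (if i = 0 then snd (advance p) \<in> {- 1.1..1.1}
      else 0.07 \<le> of_int (sgn i) * snd p \<and>
        of_int (sgn i) * snd (advance p) \<in> (if \<bar>i\<bar> = 1 then {1.18..2.292} else {2.341..3.85}))}"

lemma piece_uminus: "- p \<in> piece i \<Longrightarrow> p \<in> piece (- i)"
  by (auto simp: piece_def advance_uminus sgn_if split: if_splits)

definition apart :: "real \<Rightarrow> real \<Rightarrow> bool" where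
  "apart r s \<longleftrightarrow> (\<forall>k::int. 1/25 \<le> \<bar>r - s - 2 * pi * of_int k\<bar>)"

lemma apartI:
  assumes "r + 1/25 \<le> s" "s \<le> r + 6" shows "apart r s"
  unfolding apart_def
proof
  fix k :: int
  show "1/25 \<le> \<bar>r - s - 2 * pi * of_int k\<bar>"
  proof (cases "k = 0")
    case False
    then have "1 \<le> \<bar>real_of_int k\<bar>" by linarith
    then have "3.1 * 1 \<le> pi * \<bar>real_of_int k\<bar>" using pi_bounds by (intro mult_mono) auto
    then have "6.2 \<le> \<bar>2 * pi * real_of_int k\<bar>" by (simp add: abs_mult)
    moreover have "\<bar>r - s\<bar> \<le> 6" using assms by linarith
    ultimately show ?thesis by linarith
  qed (use assms in \<open>simp add: abs_if\<close>)
qed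

lemma not_apart_self: "\<not> apart r r"
  unfolding apart_def by (simp add: exI[of _ "0::int"])

lemma apart_commute: "apart r s \<longleftrightarrow> apart s r"
proof -
  have "apart s r" if "apart r s" for r s
    unfolding apart_def
  proof
    fix k :: int
    have "1/25 \<le> \<bar>r - s - 2 * pi * of_int (- k)\<bar>" using that unfolding apart_def by blast
    also have "\<dots> = \<bar>s - r - 2 * pi * of_int k\<bar>" by simp
    finally show "1/25 \<le> \<bar>s - r - 2 * pi * of_int k\<bar>" .
  qed
  then show ?thesis by blast
qed

text \<open>Opposite signs are told apart by the present angle, all other pairs by the next one. Working with the next angle
  alone would fail for pieces \<open>2\<close> and \<open>- 2\<close>, which overlap modulo \<open>2 * pi\<close> near angle \<open>pi\<close>.\<close>

lemma pieces_apart_less: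
  assumes p: "p \<in> piece i" "q \<in> piece j" and ij: "i < j" "-2 \<le> i" "j \<le> 2"
  shows "apart (snd p) (snd q) \<or> apart (snd (advance p)) (snd (advance q))"
proof -
  have pos: "0.07 \<le> snd p \<and> snd p \<le> 1.1 \<and> 1.18 \<le> snd (advance p) \<and> snd (advance p) \<le> 3.85"
    if "p \<in> piece i" "0 < i" for p i
    using that unfolding piece_def by (simp split: if_splits)
  have neg: "- 1.1 \<le> snd p \<and> snd p \<le> - 0.07 \<and> - 3.85 \<le> snd (advance p) \<and> snd (advance p) \<le> - 1.18"
    if "p \<in> piece i" "i < 0" for p i
    using that unfolding piece_def by (simp split: if_splits)
  have zero: "- 1.1 \<le> snd (advance p) \<and> snd (advance p) \<le> 1.1" if "p \<in> piece 0" for p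
    using that unfolding piece_def by simp
  consider "i < 0" "0 < j" | "i = 0" "0 < j" | "i < 0" "j = 0" | "i = 1" "j = 2" | "i = - 2" "j = - 1"
    using ij by linarith
  then show ?thesis
  proof cases
    case 1
    then show ?thesis using pos[OF p(2)] neg[OF p(1)] by (intro disjI1 apartI) force+
  next
    case 2
    then show ?thesis using pos[OF p(2)] zero[of p] p(1) by (intro disjI2 apartI) auto
  next
    case 3
    then show ?thesis using neg[OF p(1)] zero[of q] p(2) by (intro disjI2 apartI) auto
  next
    case 4
    then show ?thesis using p by (intro disjI2 apartI) (simp_all add: piece_def)
  next
    case 5
    then show ?thesis using p by (intro disjI2 apartI) (simp_all add: piece_def)
  qed
qed

lemma pieces_apart:
  assumes "p \<in> piece i" "q \<in> piece j" "i \<noteq> j" "i \<in> {-2..2}" "j \<in> {-2..2}"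
  shows "apart (snd p) (snd q) \<or> apart (snd (advance p)) (snd (advance q))"
  using pieces_apart_less[OF assms(1,2)] pieces_apart_less[OF assms(2,1)] assms(3-5) apart_commute
  by (metis atLeastAtMost_iff linorder_neqE)

text \<open>The fixed point at the origin stretches the window across itself.\<close>

lemma crossing_stay:
  assumes "crossing \<gamma> a b"
  obtains a' b' where "{a'..b'} \<subseteq> {a..b}" "\<gamma> ` {a'..b'} \<subseteq> piece 0" "crossing (\<lambda>t. advance (\<gamma> t)) a' b'"
proof -
  define w where "w t = snd (advance (\<gamma> t))" for t
  have cont: "continuous_on {a..b} \<gamma>" using assms by (simp add: crossing_def)
  then have cw: "continuous_on {a..b} w"
    using continuous_on_advance_pow[OF cont, of 1] unfolding w_def by (intro continuous_on_snd) simp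
  have win: "\<gamma> t \<in> window" if "t \<in> {a..b}" for t using assms that by (auto simp: crossing_def)
  have F: "2 \<le> nbr_sum 1.1" by (rule nbr_sum_ge; simp add: power_divide)
  have u: "\<bar>fst (\<gamma> t)\<bar> \<le> 0.9" if "t \<in> {a..b}" for t
    using window_abs_fst[of "fst (\<gamma> t)" "snd (\<gamma> t)"] win[OF that] by simp
  have weq: "w t = nbr_sum (snd (\<gamma> t)) - fst (\<gamma> t)" for t by (simp add: w_def advance_def case_prod_beta)
  obtain s t where st: "s \<in> {a..b}" "snd (\<gamma> s) = - 1.1" "t \<in> {a..b}" "snd (\<gamma> t) = 1.1"
    using assms unfolding crossing_def by blast
  have ends: "w s \<le> - 1.1" "1.1 \<le> w t"
    unfolding weq st(2,4) nbr_sum_uminus using F u[OF st(1)] u[OF st(3)] by linarith+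
  obtain a' b' where ab: "{a'..b'} \<subseteq> {a..b}" "\<And>r. r \<in> {a'..b'} \<Longrightarrow> - 1.1 \<le> w r \<and> w r \<le> 1.1"
    "\<exists>r\<in>{a'..b'}. w r = - 1.1" "\<exists>r\<in>{a'..b'}. w r = 1.1"
    by (rule arc_between[OF cw cw st(1) ends(1) st(3) ends(2)]) auto
  show thesis
  proof (rule that[OF ab(1)])
    have "\<gamma> t \<in> piece 0" if t: "t \<in> {a'..b'}" for t
      using ab(2)[OF t] win[of t] t ab(1) by (auto simp: piece_def w_def[symmetric] window_def case_prod_beta)
    then show "\<gamma> ` {a'..b'} \<subseteq> piece 0" by blast
    have "continuous_on {a'..b'} (\<lambda>t. advance (\<gamma> t))"
      using continuous_on_advance_pow[OF continuous_on_subset[OF cont ab(1)], of 1] by simp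
    moreover have "advance (\<gamma> t) \<in> window" if t: "t \<in> {a'..b'}" for t
    proof -
      have "t \<in> {a..b}" using t ab(1) by blast
      then have "(snd (\<gamma> t), w t) \<in> window"
        using u[of t] ab(2)[OF t] win[of t] unfolding window_iff weq by (auto simp: window_def)
      then show ?thesis by (simp add: weq advance_def case_prod_beta)
    qed
    ultimately show "crossing (\<lambda>t. advance (\<gamma> t)) a' b'"
      using ab(3,4) unfolding crossing_def w_def by blast
  qed
qed

text \<open>Cutting happens twice: first between the levels \<open>f = l\<close> and \<open>g = h\<close>, whose arrivals lie on opposite sides of the
  window, then between the points where the arrival enters and leaves the window. The sign \<open>c\<close> records the
  direction in which the arrival moves.\<close>

lemma crossing_excursion:
  fixes f g :: "real \<times> real \<Rightarrow> real"
  assumes cr: "crossing \<gamma> a b"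
    and f: "continuous_on UNIV f" and g: "continuous_on UNIV g"
    and disj: "\<And>p. p \<in> window \<Longrightarrow> f p \<le> l \<Longrightarrow> g p < h"
    and bot: "\<And>u. (u, -1.1) \<in> window \<Longrightarrow> f (u, - 1.1) \<le> l"
    and top: "\<And>u. (u, 1.1) \<in> window \<Longrightarrow> h \<le> g (u, 1.1)"
    and start: "\<And>p. p \<in> window \<Longrightarrow> f p = l \<Longrightarrow> g p \<le> h \<Longrightarrow> c * snd ((advance ^^ 4) p - (2 * pi, 2 * pi)) \<le> - 1.1"
    and stop: "\<And>p. p \<in> window \<Longrightarrow> l \<le> f p \<Longrightarrow> g p = h \<Longrightarrow> 1.1 \<le> c * snd ((advance ^^ 4) p - (2 * pi, 2 * pi))"
    and c: "c = 1 \<or> c = - 1"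
    and land: "\<And>p. p \<in> window \<Longrightarrow> l \<le> f p \<Longrightarrow> g p \<le> h \<Longrightarrow> p \<in> piece i \<and>
      (\<bar>snd ((advance ^^ 4) p - (2 * pi, 2 * pi))\<bar> \<le> 1.1 \<longrightarrow> (advance ^^ 4) p - (2 * pi, 2 * pi) \<in> window)"
  obtains a' b' where "{a'..b'} \<subseteq> {a..b}" "\<gamma> ` {a'..b'} \<subseteq> piece i"
    "crossing (\<lambda>t. (advance ^^ 4) (\<gamma> t) - (2 * pi, 2 * pi)) a' b'"
proof -
  have cont: "continuous_on {a..b} \<gamma>" using cr by (simp add: crossing_def)
  have win: "\<gamma> t \<in> window" if "t \<in> {a..b}" for t using cr that by (auto simp: crossing_def)
  obtain s t where st: "s \<in> {a..b}" "snd (\<gamma> s) = - 1.1" "t \<in> {a..b}" "snd (\<gamma> t) = 1.1"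
    using cr unfolding crossing_def by blast
  have cf: "continuous_on {a..b} (\<lambda>t. f (\<gamma> t))" "continuous_on {a..b} (\<lambda>t. g (\<gamma> t))"
    using continuous_on_compose2[OF f cont] continuous_on_compose2[OF g cont] by auto
  have "f (\<gamma> s) \<le> l" "h \<le> g (\<gamma> t)"
    using bot[of "fst (\<gamma> s)"] top[of "fst (\<gamma> t)"] win[OF st(1)] win[OF st(3)] st(2,4)
    by (metis prod.collapse)+
  then obtain a1 b1 where ab1: "{a1..b1} \<subseteq> {a..b}" "\<And>r. r \<in> {a1..b1} \<Longrightarrow> l \<le> f (\<gamma> r) \<and> g (\<gamma> r) \<le> h"
    "\<exists>r\<in>{a1..b1}. f (\<gamma> r) = l" "\<exists>r\<in>{a1..b1}. g (\<gamma> r) = h"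
    using arc_between[OF cf st(1) _ st(3)] disj win by blast
  define y where "y t = (advance ^^ 4) (\<gamma> t) - (2 * pi, 2 * pi)" for t
  have cy: "continuous_on {a1..b1} y"
    unfolding y_def using continuous_on_advance_pow[OF continuous_on_subset[OF cont ab1(1)]]
    by (intro continuous_intros)
  have cy': "continuous_on {a1..b1} (\<lambda>t. c * snd (y t))" by (intro continuous_intros cy)
  obtain s1 t1 where st1: "s1 \<in> {a1..b1}" "c * snd (y s1) \<le> - 1.1" "t1 \<in> {a1..b1}" "1.1 \<le> c * snd (y t1)"
    using ab1 start stop win unfolding y_def by (meson subsetD)
  obtain a' b' where ab: "{a'..b'} \<subseteq> {a1..b1}"
    "\<And>r. r \<in> {a'..b'} \<Longrightarrow> - 1.1 \<le> c * snd (y r) \<and> c * snd (y r) \<le> 1.1"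
    "\<exists>r\<in>{a'..b'}. c * snd (y r) = - 1.1" "\<exists>r\<in>{a'..b'}. c * snd (y r) = 1.1"
    by (rule arc_between[OF cy' cy' st1]) auto
  have sub: "t \<in> {a..b}" "\<gamma> t \<in> window" "l \<le> f (\<gamma> t)" "g (\<gamma> t) \<le> h" if "t \<in> {a'..b'}" for t
    using that ab(1) ab1(1,2) win by blast+
  have small: "\<bar>snd (y t)\<bar> \<le> 1.1" if "t \<in> {a'..b'}" for t using ab(2)[OF that] c by auto
  show thesis
  proof (rule that)
    show "{a'..b'} \<subseteq> {a..b}" using sub by blast
    show "\<gamma> ` {a'..b'} \<subseteq> piece i" using land sub by blast
    have "y ` {a'..b'} \<subseteq> window" using land sub small unfolding y_def by blast
    moreover have "\<exists>r\<in>{a'..b'}. snd (y r) = - 1.1" "\<exists>r\<in>{a'..b'}. snd (y r) = 1.1"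
      using ab(3,4) c by force+
    ultimately show "crossing (\<lambda>t. (advance ^^ 4) (\<gamma> t) - (2 * pi, 2 * pi)) a' b'"
      using continuous_on_subset[OF cy ab(1)] unfolding crossing_def y_def by blast
  qed
qed

text \<open>The arc ends where \<open>z = 1.96\<close> and where \<open>z = 0.85\<close>. The first value is small enough for the next angle to
  exceed \<open>1.1 + 1/25\<close>, which keeps the arc apart from piece 0.\<close>

lemma crossing_first:
  assumes "crossing \<gamma> a b"
  obtains a' b' where "{a'..b'} \<subseteq> {a..b}" "\<gamma> ` {a'..b'} \<subseteq> piece 1"
    "crossing (\<lambda>t. (advance ^^ 4) (\<gamma> t) - (2 * pi, 2 * pi)) a' b'"
proof (rule crossing_excursion[OF assms, of "\<lambda>p. snd (advance p)" "\<lambda>p. snd (advance p)" "pi - 1.96" "pi - 0.85" 1 1])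
  have F: "3.98 \<le> nbr_sum 1.1" by (rule nbr_sum_ge; simp add: power_divide)
  show "continuous_on UNIV (\<lambda>p. snd (advance p))"
    using continuous_on_advance_pow[OF continuous_on_id, of UNIV 1] by (intro continuous_on_snd) simp
  then show "continuous_on UNIV (\<lambda>p. snd (advance p))" .
  show "snd (advance (u, - 1.1)) \<le> pi - 1.96" if "(u, - 1.1) \<in> window" for u
    using F window_abs_fst[OF that] pi_bounds by (simp add: advance_def nbr_sum_uminus)
  show "pi - 0.85 \<le> snd (advance (u, 1.1))" if "(u, 1.1) \<in> window" for u
    using F window_abs_fst[OF that] pi_bounds by (simp add: advance_def)
  fix p assume p: "p \<in> window"
  obtain u v where uv: "p = (u, v)" by (cases p)
  obtain u' v' where uv': "(u', v') = (advance ^^ 4) p - (2 * pi, 2 * pi)" by (metis surj_pair)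
  note land = uv'[unfolded uv]
  have v': "snd ((advance ^^ 4) p - (2 * pi, 2 * pi)) = v'" using uv' by (metis snd_conv)
  have w: "snd (advance p) = nbr_sum v - u" by (simp add: uv advance_def)
  show "1 * snd ((advance ^^ 4) p - (2 * pi, 2 * pi)) \<le> - 1.1" if "snd (advance p) = pi - 1.96"
    using landing_low_first[OF p[unfolded uv] that[unfolded w] land] v' by simp
  show "1.1 \<le> 1 * snd ((advance ^^ 4) p - (2 * pi, 2 * pi))" if "snd (advance p) = pi - 0.85"
    using landing_high[OF p[unfolded uv] that[unfolded w] _ _ land] v' by simp
  assume A: "pi - 1.96 \<le> snd (advance p)" "snd (advance p) \<le> pi - 0.85"
  have z: "nbr_sum v - u = pi - (pi - (nbr_sum v - u))" "- 0.7 \<le> pi - (nbr_sum v - u)" "pi - (nbr_sum v - u) \<le> 1.96"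
    using A by (auto simp: w)
  have x2: "1.18 \<le> nbr_sum v - u" using A pi_bounds by (auto simp: w)
  have "p \<in> piece 1"
    using A pi_bounds excursion_start_bounds[OF p[unfolded uv] x2] unfolding piece_def mem_Collect_eq w by (simp add: uv)
  moreover have "(u', v') \<in> window" if "\<bar>v'\<bar> \<le> 1.1"
    by (rule landing[OF p[unfolded uv] z land that])
  ultimately show "p \<in> piece 1 \<and> (\<bar>snd ((advance ^^ 4) p - (2 * pi, 2 * pi))\<bar> \<le> 1.1 \<longrightarrow>
       (advance ^^ 4) p - (2 * pi, 2 * pi) \<in> window)"
    using uv' v' by metis
qed (use that in auto)

text \<open>The arc starts where \<open>z = 0.8\<close>, a little beyond the end \<open>z = 0.85\<close> of the previous one, so that the two are
  apart.\<close>

lemma crossing_second: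
  assumes "crossing \<gamma> a b"
  obtains a' b' where "{a'..b'} \<subseteq> {a..b}" "\<gamma> ` {a'..b'} \<subseteq> piece 2"
    "crossing (\<lambda>t. (advance ^^ 4) (\<gamma> t) - (2 * pi, 2 * pi)) a' b'"
proof (rule crossing_excursion[OF assms, of "\<lambda>p. snd (advance p)" "\<lambda>p. nbr_sum (snd p) + snd (advance p) - pi"
      "pi - 0.8" "3.9" "- 1" 2])
  have F: "3.98 \<le> nbr_sum 1.1" by (rule nbr_sum_ge; simp add: power_divide)
  show c: "continuous_on UNIV (\<lambda>p. snd (advance p))"
    using continuous_on_advance_pow[OF continuous_on_id, of UNIV 1] by (intro continuous_on_snd) simp
  show "continuous_on UNIV (\<lambda>p. nbr_sum (snd p) + snd (advance p) - pi)"
    by (intro continuous_intros c)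
  show "snd (advance (u, - 1.1)) \<le> pi - 0.8" if "(u, - 1.1) \<in> window" for u
    using F window_abs_fst[OF that] pi_bounds by (simp add: advance_def nbr_sum_uminus)
  show "3.9 \<le> nbr_sum (snd (u, 1.1)) + snd (advance (u, 1.1)) - pi" if "(u, 1.1) \<in> window" for u
    using F window_abs_fst[OF that] pi_bounds by (simp add: advance_def)
  fix p assume p: "p \<in> window"
  obtain u v where uv: "p = (u, v)" by (cases p)
  obtain u' v' where uv': "(u', v') = (advance ^^ 4) p - (2 * pi, 2 * pi)" by (metis surj_pair)
  note land = uv'[unfolded uv]
  have v': "snd ((advance ^^ 4) p - (2 * pi, 2 * pi)) = v'" using uv' by (metis snd_conv)
  have w: "snd (advance p) = nbr_sum v - u" by (simp add: uv advance_def)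
  show "nbr_sum (snd p) + snd (advance p) - pi < 3.9" if "snd (advance p) \<le> pi - 0.8"
    using that window_abs_fst[OF p[unfolded uv]] pi_bounds unfolding w by (simp add: uv)
  show "- 1 * snd ((advance ^^ 4) p - (2 * pi, 2 * pi)) \<le> - 1.1" if "snd (advance p) = pi - 0.8"
    using landing_high[OF p[unfolded uv] that[unfolded w] _ _ land] v' by simp
  have z: "nbr_sum v - u = pi - (pi - (nbr_sum v - u))" by simp
  show "1.1 \<le> - 1 * snd ((advance ^^ 4) p - (2 * pi, 2 * pi))"
    if "pi - 0.8 \<le> snd (advance p)" "nbr_sum (snd p) + snd (advance p) - pi = 3.9"
  proof -
    have "pi - (nbr_sum v - u) \<le> 0.8" "nbr_sum v - (pi - (nbr_sum v - u)) = 3.9"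
      using that unfolding w by (simp_all add: uv)
    from landing_low_second[OF p[unfolded uv] z this land] v' show ?thesis by simp
  qed
  assume A: "pi - 0.8 \<le> snd (advance p)" "nbr_sum (snd p) + snd (advance p) - pi \<le> 3.9"
  have x2: "1.18 \<le> nbr_sum v - u" using A pi_bounds by (auto simp: w)
  note wf = excursion_start_bounds[OF p[unfolded uv] x2]
  have zb: "- 0.7 \<le> pi - (nbr_sum v - u)" "pi - (nbr_sum v - u) \<le> 1.96"
    using A pi_bounds wf unfolding w by (simp_all add: uv)
  have "p \<in> piece 2"
    using A pi_bounds wf zb unfolding piece_def mem_Collect_eq w by (simp add: uv)
  moreover have "(u', v') \<in> window" if "\<bar>v'\<bar> \<le> 1.1"
    by (rule landing[OF p[unfolded uv] z zb land that])
  ultimately show "p \<in> piece 2 \<and> (\<bar>snd ((advance ^^ 4) p - (2 * pi, 2 * pi))\<bar> \<le> 1.1 \<longrightarrow>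
       (advance ^^ 4) p - (2 * pi, 2 * pi) \<in> window)"
    using uv' v' by metis
qed (use that in auto)

definition lattice :: "(real \<times> real) set" where
  "lattice = {(2 * pi * of_int k, 2 * pi * of_int l) |k l. True}"

definition delay :: "int \<Rightarrow> nat" where "delay i = (if i = 0 then 1 else 4)"

text \<open>The system is odd, so negative pieces come from the positive ones applied to the reflected arc.\<close>

lemma crossing_piece:
  assumes "crossing \<gamma> a b" "i \<in> {-2..2}"
  shows "\<exists>a' b' z. {a'..b'} \<subseteq> {a..b} \<and> \<gamma> ` {a'..b'} \<subseteq> piece i \<and> z \<in> lattice \<and>
    crossing (\<lambda>t. (advance ^^ delay i) (\<gamma> t) - z) a' b'"
proof -
  let ?q = "(2 * pi, 2 * pi)"
  have lat: "(0, 0) \<in> lattice" "?q \<in> lattice" "- ?q \<in> lattice"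
    unfolding lattice_def
    by (force intro: exI[of _ "0::int"], force intro: exI[of _ "1::int"], force intro: exI[of _ "-1::int"])
  have pos: "\<exists>a' b'. {a'..b'} \<subseteq> {a..b} \<and> \<gamma> ` {a'..b'} \<subseteq> piece j \<and> crossing (\<lambda>t. (advance ^^ 4) (\<gamma> t) - ?q) a' b'"
    if "j = 1 \<or> j = 2" "crossing \<gamma> a b" for \<gamma> j
    using that(1) crossing_first[OF that(2)] crossing_second[OF that(2)] by metis
  consider "i = 0" | "i = 1 \<or> i = 2" | "- i = 1 \<or> - i = 2" using assms(2) by force
  then show ?thesis
  proof cases
    case 1
    obtain a' b' where "{a'..b'} \<subseteq> {a..b}" "\<gamma> ` {a'..b'} \<subseteq> piece 0" "crossing (\<lambda>t. advance (\<gamma> t)) a' b'"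
      by (rule crossing_stay[OF assms(1)])
    then show ?thesis using lat(1) 1
      by (intro exI[of _ a'] exI[of _ b'] exI[of _ "(0, 0)"]) (simp add: delay_def flip: zero_prod_def)
  next
    case 2
    obtain a' b' where "{a'..b'} \<subseteq> {a..b}" "\<gamma> ` {a'..b'} \<subseteq> piece i"
      "crossing (\<lambda>t. (advance ^^ 4) (\<gamma> t) - ?q) a' b'"
      using pos[OF 2 assms(1)] by blast
    moreover have "delay i = 4" using 2 by (auto simp: delay_def)
    ultimately show ?thesis using lat(2) by metis
  next
    case 3
    obtain a' b' where ab: "{a'..b'} \<subseteq> {a..b}" "(\<lambda>t. - \<gamma> t) ` {a'..b'} \<subseteq> piece (- i)"
      "crossing (\<lambda>t. (advance ^^ 4) (- \<gamma> t) - ?q) a' b'"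
      using pos[OF 3 crossing_uminus[OF assms(1)]] by blast
    have "\<gamma> ` {a'..b'} \<subseteq> piece i" using ab(2) piece_uminus[of _ "- i"] by fastforce
    moreover have "crossing (\<lambda>t. (advance ^^ 4) (\<gamma> t) - - ?q) a' b'"
    proof -
      have "- ((advance ^^ 4) (- p) - ?q) = (advance ^^ 4) p - - ?q" for p
        by (simp only: advance_pow_uminus minus_diff_eq diff_minus_eq_add add.commute)
      then show ?thesis using crossing_uminus[OF ab(3)] by simp
    qed
    moreover have "delay i = 4" using 3 by (auto simp: delay_def)
    ultimately show ?thesis using lat(3) ab(1) by metis
  qed
qed

section \<open>Counting separated orbits\<close>

lemma advance_minus_lattice:
  assumes "z \<in> lattice"
  shows "\<exists>z'\<in>lattice. \<forall>p. advance (p - z) = advance p - z'"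
proof -
  obtain k l where z: "z = (2 * pi * of_int k, 2 * pi * of_int l)"
    using assms unfolding lattice_def by blast
  have "sin (v - 2 * pi * of_int l) = sin v" for v
    using sin.plus_of_int[of v "- l"] by (simp add: algebra_simps)
  then have f: "nbr_sum (v - 2 * pi * of_int l) = nbr_sum v - 4 * pi * of_int l" for v
    by (simp add: nbr_sum_def algebra_simps)
  show ?thesis
  proof (intro bexI allI)
    show "(2 * pi * of_int l, 2 * pi * of_int (2 * l - k)) \<in> lattice"
      unfolding lattice_def by blast
    show "advance (p - z) = advance p - (2 * pi * of_int l, 2 * pi * of_int (2 * l - k))" for p
      using f[of "snd p"] by (simp add: advance_def case_prod_beta z) (simp add: algebra_simps)
  qed
qed

lemma advance_pow_minus_lattice:
  assumes "z \<in> lattice"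
  shows "\<exists>z'\<in>lattice. \<forall>p. (advance ^^ n) (p - z) = (advance ^^ n) p - z'"
proof (induction n)
  case 0
  then show ?case using assms by auto
next
  case (Suc n)
  then obtain z1 where z1: "z1 \<in> lattice" "\<forall>p. (advance ^^ n) (p - z) = (advance ^^ n) p - z1"
    by blast
  obtain z2 where "z2 \<in> lattice" "\<forall>p. advance (p - z1) = advance p - z2"
    using advance_minus_lattice[OF z1(1)] by blast
  then show ?case using z1(2) by (intro bexI[of _ z2] allI) (simp_all del: split_paired_All)
qed

lemma apart_translate: "apart (r - c) (s - c) \<longleftrightarrow> apart r s"
  by (simp add: apart_def)

definition separating :: "nat \<Rightarrow> real \<times> real \<Rightarrow> real \<times> real \<Rightarrow> bool" where
  "separating n p q \<longleftrightarrow> (\<exists>k<n. apart (snd ((advance ^^ k) p)) (snd ((advance ^^ k) q)))"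

text \<open>Translations by the lattice do not change differences of angles, so an arc may be moved back to the
  window at the origin without affecting separation.\<close>

lemma separating_shift:
  assumes "z \<in> lattice" "separating n ((advance ^^ d) p - z) ((advance ^^ d) q - z)"
  shows "separating (n + d) p q"
proof -
  obtain k where k: "k < n" "apart (snd ((advance ^^ k) ((advance ^^ d) p - z))) (snd ((advance ^^ k) ((advance ^^ d) q - z)))"
    using assms(2) unfolding separating_def by blast
  obtain z' where "\<forall>p. (advance ^^ k) (p - z) = (advance ^^ k) p - z'"
    using advance_pow_minus_lattice[OF assms(1)] by blast
  then have "apart (snd ((advance ^^ (k + d)) p)) (snd ((advance ^^ (k + d)) q))"
    using k(2) by (simp add: apart_translate funpow_add del: split_paired_All)
  then show ?thesis using k(1) unfolding separating_def by (intro exI[of _ "k + d"]) auto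
qed

text \<open>The number of itineraries of length \<open>n\<close>: each is a word in one letter of length 1 and four letters of length 4.\<close>

fun orbit_count :: "nat \<Rightarrow> nat" where
  "orbit_count n = (if n < 4 then 1 else orbit_count (n - 1) + 4 * orbit_count (n - 4))"

declare orbit_count.simps [simp del]

text \<open>The recursion for \<open>orbit_count\<close> has growth rate the positive root \<open>1.7484...\<close> of
  \<open>\<lambda>^4 = \<lambda>^3 + 4\<close>; a number slightly below it satisfies the inequality needed for the induction.\<close>

lemma orbit_count_ge: "(1.74::real) ^ n \<le> 6 * real (orbit_count n)"
proof (induction n rule: less_induct)
  case (less n)
  show ?case
  proof (cases "n < 4")
    case True
    have "(1.74::real) ^ n \<le> 1.74 ^ 3" using True by (intro power_increasing) auto
    also have "\<dots> \<le> 6" by (simp add: power_divide)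
    finally show ?thesis using True by (simp add: orbit_count.simps)
  next
    case False
    define m where "m = n - 4"
    have n: "n = m + 4" using False by (simp add: m_def)
    have "(1.74::real) ^ n = 1.74 ^ m * 1.74 ^ 4" by (simp add: n power_add)
    also have "\<dots> \<le> 1.74 ^ m * (1.74 ^ 3 + 4)" by (intro mult_left_mono) (auto simp: power_divide)
    also have "\<dots> = 1.74 ^ (m + 3) + 4 * 1.74 ^ m" by (simp add: power_add algebra_simps)
    also have "\<dots> \<le> 6 * real (orbit_count (m + 3)) + 4 * (6 * real (orbit_count m))"
      using less.IH[of "m + 3"] less.IH[of m] n by (intro add_mono mult_left_mono) auto
    also have "\<dots> = 6 * real (orbit_count n)" by (subst orbit_count.simps[of n]) (simp add: n add.commute)
    finally show ?thesis .
  qed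
qed

text \<open>Each of the five sub-arcs supplies, by induction, the separated points of its remaining itinerary, and points of
  different sub-arcs are separated within the first two steps.\<close>

lemma separated_orbits:
  assumes "crossing \<gamma> a b"
  shows "\<exists>W\<subseteq>{a..b}. finite W \<and> card W = orbit_count n \<and>
    (\<forall>s\<in>W. \<forall>t\<in>W. s \<noteq> t \<longrightarrow> separating n (\<gamma> s) (\<gamma> t))"
  using assms
proof (induction n arbitrary: \<gamma> a b rule: less_induct)
  case (less n)
  show ?case
  proof (cases "n < 4")
    case True
    obtain t where "t \<in> {a..b}" using less.prems unfolding crossing_def by blast
    then show ?thesis using True by (intro exI[of _ "{t}"]) (simp add: orbit_count.simps)
  next
    case False
    have "\<exists>W. W \<subseteq> {a..b} \<and> \<gamma> ` W \<subseteq> piece i \<and> finite W \<and> card W = orbit_count (n - delay i) \<and>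
        (\<forall>s\<in>W. \<forall>t\<in>W. s \<noteq> t \<longrightarrow> separating n (\<gamma> s) (\<gamma> t))" if i: "i \<in> {-2..2}" for i
    proof -
      have d: "0 < delay i" "delay i \<le> n" using False by (auto simp: delay_def)
      obtain a' b' z where p: "{a'..b'} \<subseteq> {a..b}" "\<gamma> ` {a'..b'} \<subseteq> piece i" "z \<in> lattice"
        "crossing (\<lambda>t. (advance ^^ delay i) (\<gamma> t) - z) a' b'"
        using crossing_piece[OF less.prems i] by blast
      have "n - delay i < n" using d by simp
      from less.IH[OF this p(4)] obtain W where W: "W \<subseteq> {a'..b'}" "finite W" "card W = orbit_count (n - delay i)"
        "\<And>s t. s \<in> W \<Longrightarrow> t \<in> W \<Longrightarrow> s \<noteq> t \<Longrightarrow>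
           separating (n - delay i) ((advance ^^ delay i) (\<gamma> s) - z) ((advance ^^ delay i) (\<gamma> t) - z)"
        by blast
      have "separating n (\<gamma> s) (\<gamma> t)" if "s \<in> W" "t \<in> W" "s \<noteq> t" for s t
        using separating_shift[OF p(3) W(4)[OF that]] d by simp
      then show ?thesis using W(1-3) p(1,2) by (intro exI[of _ W]) blast
    qed
    then have "\<forall>i\<in>{-2..2}. \<exists>W. W \<subseteq> {a..b} \<and> \<gamma> ` W \<subseteq> piece i \<and> finite W \<and> card W = orbit_count (n - delay i) \<and>
        (\<forall>s\<in>W. \<forall>t\<in>W. s \<noteq> t \<longrightarrow> separating n (\<gamma> s) (\<gamma> t))" by blast
    then obtain W where "\<forall>i\<in>{-2..2}. W i \<subseteq> {a..b} \<and> \<gamma> ` W i \<subseteq> piece i \<and> finite (W i) \<and>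
        card (W i) = orbit_count (n - delay i) \<and> (\<forall>s\<in>W i. \<forall>t\<in>W i. s \<noteq> t \<longrightarrow> separating n (\<gamma> s) (\<gamma> t))"
      by (rule bchoice[THEN exE])
    then have W: "W i \<subseteq> {a..b}" "\<gamma> ` W i \<subseteq> piece i" "finite (W i)" "card (W i) = orbit_count (n - delay i)"
      "\<And>s t. s \<in> W i \<Longrightarrow> t \<in> W i \<Longrightarrow> s \<noteq> t \<Longrightarrow> separating n (\<gamma> s) (\<gamma> t)" if "i \<in> {-2..2}" for i
      using that by blast+
    have sep: "separating 2 (\<gamma> s) (\<gamma> t)" if "i \<in> {-2..2}" "j \<in> {-2..2}" "i \<noteq> j" "s \<in> W i" "t \<in> W j" for i j s t
    proof -
      have "\<gamma> s \<in> piece i" "\<gamma> t \<in> piece j" using that W(2) by blast+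
      from pieces_apart[OF this that(3,1,2)] show ?thesis
      proof
        assume "apart (snd (\<gamma> s)) (snd (\<gamma> t))"
        then show ?thesis unfolding separating_def by (intro exI[of _ 0]) simp
      next
        assume "apart (snd (advance (\<gamma> s))) (snd (advance (\<gamma> t)))"
        then show ?thesis unfolding separating_def by (intro exI[of _ 1]) simp
      qed
    qed
    have irrefl: "\<not> separating m p p" for m p using not_apart_self by (simp add: separating_def)
    have "card (\<Union>i\<in>{-2..2}. W i) = (\<Sum>i\<in>{-2..2::int}. orbit_count (n - delay i))"
    proof -
      have "W i \<inter> W j = {}" if "i \<in> {-2..2}" "j \<in> {-2..2}" "i \<noteq> j" for i j
        using sep[OF that] irrefl by blast
      then show ?thesis using W(3,4) by (subst card_UN_disjoint) simp_all
    qed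
    also have "\<dots> = orbit_count n"
    proof -
      have "{-2..2::int} = {-2, -1, 0, 1, 2}" by auto
      then show ?thesis using False by (simp add: delay_def orbit_count.simps[of n])
    qed
    finally have "card (\<Union>i\<in>{-2..2}. W i) = orbit_count n" .
    moreover have "separating n (\<gamma> s) (\<gamma> t)"
      if st: "s \<in> (\<Union>i\<in>{-2..2}. W i)" "t \<in> (\<Union>i\<in>{-2..2}. W i)" "s \<noteq> t" for s t
    proof -
      obtain i where i: "i \<in> {-2..2}" "s \<in> W i" using st(1) by blast
      obtain j where j: "j \<in> {-2..2}" "t \<in> W j" using st(2) by blast
      show ?thesis
      proof (cases "i = j")
        case True
        then show ?thesis using W(5)[of i s t] i j st(3) by simp
      next
        case neq: False
        obtain k where "k < 2" "apart (snd ((advance ^^ k) (\<gamma> s))) (snd ((advance ^^ k) (\<gamma> t)))"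
          using sep[OF i(1) j(1) neq i(2) j(2)] unfolding separating_def by blast
        then show ?thesis using False unfolding separating_def by (intro exI[of _ k]) simp
      qed
    qed
    moreover have "(\<Union>i\<in>{-2..2}. W i) \<subseteq> {a..b}" using W(1) by (rule UN_least)
    moreover have "finite (\<Union>i\<in>{-2..2}. W i)" using W(3) by (intro finite_UN_I) simp_all
    ultimately show ?thesis by (intro exI[of _ "\<Union>i\<in>{-2..2}. W i"] conjI ballI impI)
  qed
qed

section \<open>Topological entropy of the standard map\<close>

text \<open>Angles \<open>(\<theta>\<^bsub>n-1\<^esub>, \<theta>\<^bsub>n\<^esub>)\<close> become position and momentum, the momentum being the last
  increment of the position.\<close>

definition to_torus :: "real \<times> real \<Rightarrow> torus" where
  "to_torus p = torus_proj (snd p / (2 * pi), (snd p - fst p) / (2 * pi))"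

lemma standard_map_to_torus: "standard_map 2 (to_torus p) = to_torus (advance p)"
proof -
  have "standard_lift 2 (snd p / (2 * pi), (snd p - fst p) / (2 * pi)) =
      (snd (advance p) / (2 * pi), (snd (advance p) - fst (advance p)) / (2 * pi))"
    by (simp add: standard_lift_def advance_def case_prod_beta nbr_sum_def field_simps)
  then show ?thesis by (simp add: to_torus_def standard_map.abs_eq)
qed

lemma standard_map_pow_to_torus: "(standard_map 2 ^^ n) (to_torus p) = to_torus ((advance ^^ n) p)"
  by (induction n) (simp_all add: standard_map_to_torus)

text \<open>A gap of \<open>1/25\<close> in the angle is a gap of \<open>1 / (50 * pi) > 1/160\<close> in the position.\<close>

lemma apart_imp_dist_to_torus:
  assumes "apart (snd p) (snd q)"
  shows "1/200 < dist (to_torus p) (to_torus q)"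
proof (rule ccontr)
  assume "\<not> 1/200 < dist (to_torus p) (to_torus q)"
  then have "dist (torus_proj (snd p / (2 * pi), (snd p - fst p) / (2 * pi))) (to_torus q) < 1/160"
    by (simp add: to_torus_def)
  then obtain v where v: "torus_proj v = to_torus q" "dist (snd p / (2 * pi), (snd p - fst p) / (2 * pi)) v < 1/160"
    by (rule torus_dist_lift)
  obtain k where "fst v - snd q / (2 * pi) = of_int k"
    using v(1) by (auto simp: to_torus_def torus_proj_eq_iff torus_rel_def elim!: Ints_cases)
  then have k: "fst v = snd q / (2 * pi) + of_int k" by simp
  have "\<bar>snd p / (2 * pi) - fst v\<bar> < 1/160"
    using dist_fst_le[of "(snd p / (2 * pi), (snd p - fst p) / (2 * pi))" v] v(2)
    by (simp add: dist_real_def)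
  then have "2 * pi * \<bar>snd p / (2 * pi) - fst v\<bar> < 2 * pi * (1/160)"
    by (intro mult_strict_left_mono) auto
  also have "2 * pi * \<bar>snd p / (2 * pi) - fst v\<bar> = \<bar>2 * pi * (snd p / (2 * pi) - fst v)\<bar>"
    by (simp add: abs_mult)
  also have "2 * pi * (snd p / (2 * pi) - fst v) = snd p - snd q - 2 * pi * of_int k"
    by (simp add: k field_simps)
  finally have "\<bar>snd p - snd q - 2 * pi * of_int k\<bar> < 1/25" using pi_bounds by simp
  then show False using assms unfolding apart_def by (meson not_le)
qed

text \<open>The segment on which the first angle is 0 crosses the window.\<close>

lemma orbit_count_le_max_separated:
  "orbit_count n \<le> max_separated UNIV (standard_map 2) n (1/200)"
proof -
  define \<gamma> :: "real \<Rightarrow> real \<times> real" where "\<gamma> t = (0, t)" for t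
  have "crossing \<gamma> (- 1.1) 1.1"
    unfolding crossing_def
  proof (intro conjI)
    show "continuous_on {- 1.1..1.1} \<gamma>" unfolding \<gamma>_def by (intro continuous_intros)
    show "\<gamma> ` {- 1.1..1.1} \<subseteq> window" by (auto simp: \<gamma>_def window_iff)
    show "\<exists>t\<in>{- 1.1..1.1}. snd (\<gamma> t) = - 1.1" by (intro bexI[of _ "- 1.1"]) (simp_all add: \<gamma>_def)
    show "\<exists>t\<in>{- 1.1..1.1}. snd (\<gamma> t) = 1.1" by (intro bexI[of _ "1.1"]) (simp_all add: \<gamma>_def)
  qed
  then obtain W where W: "card W = orbit_count n"
    "\<And>s t. s \<in> W \<Longrightarrow> t \<in> W \<Longrightarrow> s \<noteq> t \<Longrightarrow> separating n (\<gamma> s) (\<gamma> t)"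
    using separated_orbits by blast
  have far: "\<exists>k<n. 1/200 < dist ((standard_map 2 ^^ k) (to_torus (\<gamma> s))) ((standard_map 2 ^^ k) (to_torus (\<gamma> t)))"
    if "s \<in> W" "t \<in> W" "s \<noteq> t" for s t
    using W(2)[OF that] apart_imp_dist_to_torus
    unfolding separating_def standard_map_pow_to_torus by blast
  have "inj_on (\<lambda>t. to_torus (\<gamma> t)) W"
  proof (rule inj_onI, rule ccontr)
    fix s t assume "s \<in> W" "t \<in> W" "to_torus (\<gamma> s) = to_torus (\<gamma> t)" "s \<noteq> t"
    then show False using far[of s t] by auto
  qed
  then have "card ((\<lambda>t. to_torus (\<gamma> t)) ` W) = orbit_count n" using W(1) by (simp add: card_image)
  moreover have "separated_set (standard_map 2) n (1/200) ((\<lambda>t. to_torus (\<gamma> t)) ` W)"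
    unfolding separated_set_def using far by blast
  ultimately show ?thesis
    using max_separated(2)[OF compact_torus continuous_on_standard_map, of 2 "1/200"] by force
qed

text \<open>From \<open>1 - x \<le> exp (- x)\<close> at \<open>x = 0.5456 / 32\<close>, raised to the power 32.\<close>

lemma exp_le_growth_rate: "exp 0.54518888942276 \<le> (1.74::real)"
proof -
  have "1 - 0.5456/32 \<le> exp (- (0.5456/32::real))"
    using exp_ge_add_one_self[of "- (0.5456/32)"] by simp
  then have "(1 - 0.5456/32::real)^32 \<le> exp (- (0.5456/32)) ^ 32"
    by (rule power_mono) simp
  also have "exp (- (0.5456/32)) ^ 32 = exp (- 0.5456::real)"
    by (simp flip: exp_of_nat_mult)
  finally have *: "(1 - 0.5456/32)^32 \<le> exp (- 0.5456::real)" .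
  have "1/1.74 \<le> (1 - 0.5456/32::real)^32" by (simp add: power_divide)
  with * have "1/1.74 \<le> exp (- 0.5456::real)" by linarith
  then have "exp 0.5456 \<le> (1.74::real)" by (simp add: exp_minus field_simps)
  then show ?thesis by (rule order_trans[rotated]) simp
qed

theorem theorem4p4:
  fixes \<epsilon> :: real
  assumes "\<epsilon> = 2"
  shows "topological_entropy (UNIV :: torus set) (standard_map \<epsilon>) \<ge> ereal 0.54518888942276"
proof -
  let ?g = "\<lambda>n. ln (real (max_separated UNIV (standard_map 2) n (1/200))) / real n"
  have "0.54518888942276 \<le> ln (1.74::real)"
    by (rule ln_ge_iff[THEN iffD2, OF _ exp_le_growth_rate]) simp
  then have "ereal 0.54518888942276 \<le> ereal (ln 1.74)"
    by (simp only: ereal_less_eq)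
  also have "(\<lambda>n. ln 1.74 - ln 6 / real n) \<longlonglongrightarrow> ln 1.74 - 0"
    by (intro tendsto_diff tendsto_const lim_const_over_n)
  then have "ereal (ln 1.74) = limsup (\<lambda>n. ereal (ln 1.74 - ln 6 / real n))"
    by (intro lim_imp_Limsup[symmetric]) simp_all
  also have "\<dots> \<le> limsup (\<lambda>n. ereal (?g n))"
  proof (intro Limsup_mono eventually_mono[OF eventually_gt_at_top[of 0]])
    fix n :: nat assume n: "0 < n"
    let ?s = "real (max_separated UNIV (standard_map 2) n (1/200))"
    have le: "(1.74::real) ^ n \<le> 6 * ?s"
      using orbit_count_ge[of n] orbit_count_le_max_separated[of n] by linarith
    have pos: "0 < (1.74::real) ^ n" by (rule zero_less_power) simp
    then have s: "0 < ?s" using le by linarith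
    have "real n * ln 1.74 = ln ((1.74::real) ^ n)" by (rule ln_realpow[symmetric])
    also have "\<dots> \<le> ln (6 * ?s)" by (rule iffD2[OF ln_le_cancel_iff, OF pos _ le]) (use s in simp)
    also have "\<dots> = ln 6 + ln ?s" by (rule ln_mult_pos) (use s in simp_all)
    finally have "(real n * ln 1.74 - ln 6) / real n \<le> ?g n" by (intro divide_right_mono) simp_all
    then show "ereal (ln 1.74 - ln 6 / real n) \<le> ereal (?g n)"
      using n by (simp only: ereal_less_eq) (simp add: diff_divide_distrib)
  qed
  also have "\<dots> \<le> topological_entropy UNIV (standard_map 2)"
    unfolding topological_entropy_def by (rule SUP_upper) simp
  finally show ?thesis using assms by simp
qed

end
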